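(* Let $\mathbb{K}$ be an $F$-finite field of prime characteristic $p$, let $R=\mathbb{K}[x_{ij}]$ with $1\leq i\leq 2$, $1\leq j\leq 3$ be the polynomial ring in six variables, and let $I$ be the ideal generated by the $2\times 2$ minors of the $2\times 3$ matrix $(x_{ij})$. Then for every ideal $\mathfrak{a}$ (homogeneous or not) of $S=R/I$, the set of $F$-jumping coefficients of $\mathfrak{a}$ is discrete.
   Context: A ring $S$ of characteristic $p$ is $F$-finite if $F^e_*S$ is a finitely generated $S$-module for all $e\ge 0$, where $F^e_*S$ is $S$ as an abelian group with $S$ acting by $s\cdot a=s^{p^e}a$; for $S$ reduced, $F^e_*S$ is identified with $S^{1/p^e}$ (so $a\in F^e_*S$ is written $a^{1/p^e}$). Test ideals: let $S$ be a reduced $F$-finite ring of characteristic $p$, $\mathfrak{a}\subseteq S$ an ideal not contained in any minimal prime of $S$, and $t>0$ real. The test ideal $\tau(\mathfrak{a}^t)$ is the unique smallest ideal $J\subseteq S$ not contained in any minimal prime of $S$ such that $\phi\big((\mathfrak{a}^{\lceil t(p^e-1)\rceil}J)^{1/p^e}\big)\subseteq J$ for all $e>0$ and all $\phi\in\operatorname{Hom}_S(F^e_*S,S)$ (it is known to exist). A real number $t>0$ is an $F$-jumping coefficient of $\mathfrak{a}$ if $\tau(\mathfrak{a}^{t-\epsilon})\supsetneq\tau(\mathfrak{a}^t)$ for all $0<\epsilon<t$. Statements about all ideals of $S$ refer to ideals for which test ideals are so defined. *)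

theory Defs
  imports
    "HOL-Analysis.Analysis"
    "HOL-Algebra.QuotRing"
    "HOL-Algebra.Ideal_Product"
    "HOL-Algebra.Module"
    "HOL-Algebra.Algebraic_Closure_Type"
    "HOL-Library.Poly_Mapping"
begin

section \<open>Modules and Frobenius\<close>

definition regular_module :: "'a ring \<Rightarrow> ('a, 'a) module" where
  "regular_module S = \<lparr>carrier = carrier S, monoid.mult = monoid.mult S, one = one S,
     ring.zero = ring.zero S, add = add S, module.smult = monoid.mult S\<rparr>"

text \<open>\<open>Frobenius_pushforward S p e\<close> is $F^e_*S$: the additive group of \<open>S\<close>, with \<open>s\<close> acting
  as multiplication by $s^{p^e}$. Its elements are written \<open>a\<close> rather than $a^{1/p^e}$. The fields
  \<open>mult\<close> and \<open>one\<close> are present only because module records extend ring records.\<close>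

definition Frobenius_pushforward :: "'a ring \<Rightarrow> nat \<Rightarrow> nat \<Rightarrow> ('a, 'a) module" where
  "Frobenius_pushforward S p e = \<lparr>carrier = carrier S, monoid.mult = monoid.mult S, one = one S,
     ring.zero = ring.zero S, add = add S,
     module.smult = (\<lambda>s a. (s [^]\<^bsub>S\<^esub> (p ^ e)) \<otimes>\<^bsub>S\<^esub> a)\<rparr>"

definition module_Hom :: "'a ring \<Rightarrow> ('a, 'b) module \<Rightarrow> ('a, 'c) module \<Rightarrow> ('b \<Rightarrow> 'c) set" where
  "module_Hom S M N = {\<phi> \<in> carrier M \<rightarrow> carrier N.
     (\<forall>x\<in>carrier M. \<forall>y\<in>carrier M. \<phi> (x \<oplus>\<^bsub>M\<^esub> y) = \<phi> x \<oplus>\<^bsub>N\<^esub> \<phi> y) \<and>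
     (\<forall>s\<in>carrier S. \<forall>x\<in>carrier M. \<phi> (s \<odot>\<^bsub>M\<^esub> x) = s \<odot>\<^bsub>N\<^esub> \<phi> x)}"

definition finitely_generated_module :: "'a ring \<Rightarrow> ('a, 'b) module \<Rightarrow> bool" where
  "finitely_generated_module S M \<longleftrightarrow>
     (\<exists>B. finite B \<and> B \<subseteq> carrier M \<and>
        (\<forall>x\<in>carrier M. \<exists>c\<in>B \<rightarrow> carrier S. x = (\<Oplus>\<^bsub>M\<^esub> b\<in>B. c b \<odot>\<^bsub>M\<^esub> b)))"

definition F_finite :: "'a ring \<Rightarrow> nat \<Rightarrow> bool" where
  "F_finite S p \<longleftrightarrow> (\<forall>e. finitely_generated_module S (Frobenius_pushforward S p e))"

section \<open>Test ideals and F-jumping coefficients\<close>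

definition minimal_prime :: "'a ring \<Rightarrow> 'a set \<Rightarrow> bool" where
  "minimal_prime S P \<longleftrightarrow> primeideal P S \<and> (\<forall>Q. primeideal Q S \<and> Q \<subseteq> P \<longrightarrow> Q = P)"

definition in_no_minimal_prime :: "'a ring \<Rightarrow> 'a set \<Rightarrow> bool" where
  "in_no_minimal_prime S J \<longleftrightarrow> (\<forall>P. minimal_prime S P \<longrightarrow> \<not> J \<subseteq> P)"

text \<open>Powers of ideals are taken in the multiplicative monoid \<open>ideals_set S\<close> of ideals, whose unit
  is the whole ring.\<close>

definition test_ideal_candidate :: "'a ring \<Rightarrow> nat \<Rightarrow> 'a set \<Rightarrow> real \<Rightarrow> 'a set \<Rightarrow> bool" where
  "test_ideal_candidate S p \<aa> t J \<longleftrightarrow>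
     ideal J S \<and> in_no_minimal_prime S J \<and>
     (\<forall>e>0. \<forall>\<phi> \<in> module_Hom S (Frobenius_pushforward S p e) (regular_module S).
        \<phi> ` ideal_prod S (\<aa> [^]\<^bsub>ideals_set S\<^esub> nat \<lceil>t * (real p ^ e - 1)\<rceil>) J \<subseteq> J)"

definition test_ideal :: "'a ring \<Rightarrow> nat \<Rightarrow> 'a set \<Rightarrow> real \<Rightarrow> 'a set" where
  "test_ideal S p \<aa> t =
     (THE J. test_ideal_candidate S p \<aa> t J \<and>
             (\<forall>J'. test_ideal_candidate S p \<aa> t J' \<longrightarrow> J \<subseteq> J'))"

definition F_jumping_coefficient :: "'a ring \<Rightarrow> nat \<Rightarrow> 'a set \<Rightarrow> real \<Rightarrow> bool" where
  "F_jumping_coefficient S p \<aa> t \<longleftrightarrow>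
     t > 0 \<and> (\<forall>\<epsilon>. 0 < \<epsilon> \<and> \<epsilon> < t \<longrightarrow> test_ideal S p \<aa> t \<subset> test_ideal S p \<aa> (t - \<epsilon>))"

section \<open>The determinantal ring\<close>

text \<open>The polynomial ring over \<open>'k\<close> in the variables indexed by \<open>2 \<times> 3\<close>: finitely supported
  functions from monomials (finitely supported exponent functions) to coefficients. The elements
  of the index types \<open>2\<close> and \<open>3\<close> are \<open>0, 1\<close> and \<open>0, 1, 2\<close>.\<close>

type_synonym 'k poly23 = "((2 \<times> 3) \<Rightarrow>\<^sub>0 nat) \<Rightarrow>\<^sub>0 'k"

definition var :: "2 \<Rightarrow> 3 \<Rightarrow> ('k::field) poly23" where
  "var i j = Poly_Mapping.single (Poly_Mapping.single (i, j) 1) 1"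

definition maximal_minors :: "('k::field) poly23 set" where
  "maximal_minors = {det (\<chi> (r::2) (s::2). var r (c s)) | c :: 2 \<Rightarrow> 3. strict_mono c}"

definition polynomial_ring_23 :: "('k::field) poly23 ring" where
  "polynomial_ring_23 = ring_of_type_algebra"

definition determinantal_ring :: "('k::field) poly23 set ring" where
  "determinantal_ring =
     polynomial_ring_23 Quot (genideal polynomial_ring_23 maximal_minors)"

end

theory Submission
  imports Defs
begin

text \<open>The proof is a degree argument. Let \<open>S\<close> be the determinantal ring. Under \<open>x\<^sub>i\<^sub>j \<mapsto> s\<^sub>i t\<^sub>j\<close> it becomes the
subring of balanced polynomials in \<open>A = K[s\<^sub>0, s\<^sub>1, t\<^sub>0, t\<^sub>1, t\<^sub>2]\<close>: those all of whose monomials have the same degree in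
\<open>s\<close> as in \<open>t\<close>. This common degree is the gauge of an element.

The key point is that maps \<open>\<phi> \<in> Hom(F\<^sup>e\<^sub>* S, S)\<close> divide gauges by \<open>q = p\<^sup>e\<close>. Over the ring of \<open>q\<close>-th powers, \<open>A\<close> has a basis
\<open>b x\<^sup>r\<close>, where \<open>b\<close> runs over a basis of \<open>K\<close> over its \<open>q\<close>-th powers and the exponents in \<open>r\<close> are below \<open>q\<close>.
Correspondingly \<open>F\<^sup>e\<^sub>* S\<close> splits into copies of graded parts \<open>A\<^sub>d\<close> of \<open>A\<close>, for the grading with \<open>deg s\<^sub>i = 1\<close> and
\<open>deg t\<^sub>j = -1\<close>. A homomorphism \<open>A\<^sub>d \<rightarrow> A\<^sub>0 = S\<close> is multiplication by an element of \<open>A\<^sub>-\<^sub>d\<close>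
(\<open>Hom_piece_is_multiplication\<close>), and \<open>A\<^sub>-\<^sub>d\<close> is generated over \<open>S\<close> by monomials in \<open>t\<close> alone if \<open>d\<close> is nonnegative
and in \<open>s\<close> alone otherwise. Hence \<open>\<phi> f\<close> is an \<open>S\<close>-combination of values \<open>\<psi> f\<close>, where \<open>\<psi>\<close> takes one coordinate of \<open>f\<close> and multiplies
it by such a monomial; the degree of \<open>\<psi> f\<close> in the other set of variables, and so its gauge, is at most that of \<open>f\<close> divided by \<open>q\<close>
(\<open>cartier_map_gauge_bound\<close>).

Now let \<open>\<aa>\<close> be generated in gauge \<open>d\<close>; such a \<open>d\<close> exists because \<open>S\<close> is noetherian (\<open>Hilbert_basis\<close>). If \<open>J\<close> is the smallest
candidate for the test ideal of \<open>\<aa>\<^sup>t\<close> and \<open>t \<le> T\<close>, then for a bound \<open>N\<close> that depends only on \<open>d\<close> and \<open>T\<close> the ideal generated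
by the elements of \<open>J\<close> of gauge at most \<open>N\<close> is again a candidate, so it equals \<open>J\<close>
(\<open>least_candidate_generated_in\<close>). The test ideals for \<open>t \<le> T\<close> are thus determined by subspaces of one finite-dimensional
vector space. They decrease strictly along the jumping coefficients, so only finitely many jumping coefficients are at most \<open>T\<close>
(\<open>finite_F_jumping_coefficients\<close>).

That the kernel of \<open>x\<^sub>i\<^sub>j \<mapsto> s\<^sub>i t\<^sub>j\<close> is the ideal of minors is the classical fact that exponent matrices with equal row and column
sums differ by elementary swaps (\<open>minors_ideal_monomials\<close>).\<close>

alias lookup = Poly_Mapping.lookup
alias single = Poly_Mapping.single
alias keys = Poly_Mapping.keys

section \<open>Rings in which Cartier maps divide a gauge\<close>

lemma module_Hom_Frobenius_iff:
  "\<phi> \<in> module_Hom S (Frobenius_pushforward S p e) (regular_module S) \<longleftrightarrow>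
     \<phi> \<in> carrier S \<rightarrow> carrier S \<and>
     (\<forall>x\<in>carrier S. \<forall>y\<in>carrier S. \<phi> (x \<oplus>\<^bsub>S\<^esub> y) = \<phi> x \<oplus>\<^bsub>S\<^esub> \<phi> y) \<and>
     (\<forall>s\<in>carrier S. \<forall>x\<in>carrier S. \<phi> ((s [^]\<^bsub>S\<^esub> (p ^ e)) \<otimes>\<^bsub>S\<^esub> x) = s \<otimes>\<^bsub>S\<^esub> \<phi> x)"
  by (simp add: module_Hom_def Frobenius_pushforward_def regular_module_def)

text \<open>\<open>V n\<close> is the set of elements of gauge at most \<open>n\<close>; for an algebra over a field, think of the elements
of degree at most \<open>n\<close>. By \<open>gauge_bound\<close>, the value of a \<open>p\<^sup>-\<^sup>e\<close>-linear map at \<open>x\<close> is a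
combination of values at \<open>x\<close> of such maps that divide the gauge of \<open>x\<close> by \<open>p\<^sup>e\<close>. By
\<open>gauge_nonzero\<close>, one of these values is nonzero if \<open>x\<close> is. By \<open>finite_chain\<close>, elements of bounded gauge
behave like a finite-dimensional vector space: a chain of traces of ideals on \<open>V n\<close> is finite.\<close>

locale gauge_bounded_ring = domain S for S :: "'a ring" (structure) +
  fixes p :: nat and V :: "nat \<Rightarrow> 'a set"
  assumes p: "2 \<le> p"
    and V_carrier: "V n \<subseteq> carrier S"
    and V_mono: "m \<le> n \<Longrightarrow> V m \<subseteq> V n"
    and V_one: "\<one> \<in> V 0"
    and V_mult: "x \<in> V m \<Longrightarrow> y \<in> V n \<Longrightarrow> x \<otimes> y \<in> V (m + n)"
    and V_exhaust: "x \<in> carrier S \<Longrightarrow> \<exists>n. x \<in> V n"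
    and fin_gen: "ideal I S \<Longrightarrow> \<exists>F. finite F \<and> F \<subseteq> I \<and> I \<subseteq> Idl F"
    and finite_chain: "(\<And>W. W \<in> \<W> \<Longrightarrow> \<exists>I. ideal I S \<and> W = I \<inter> V n) \<Longrightarrow>
       (\<And>W W'. W \<in> \<W> \<Longrightarrow> W' \<in> \<W> \<Longrightarrow> W \<subseteq> W' \<or> W' \<subseteq> W) \<Longrightarrow> finite \<W>"
    and gauge_bound: "\<phi> \<in> module_Hom S (Frobenius_pushforward S p e) (regular_module S) \<Longrightarrow>
       x \<in> V G \<Longrightarrow>
       \<phi> x \<in> Idl {\<psi> x |\<psi>. \<psi> \<in> module_Hom S (Frobenius_pushforward S p e) (regular_module S) \<and>
                            \<psi> x \<in> V (G div p ^ e)}"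
    and gauge_nonzero: "x \<in> V G \<Longrightarrow> x \<noteq> \<zero> \<Longrightarrow>
       \<exists>\<psi>\<in>module_Hom S (Frobenius_pushforward S p e) (regular_module S).
         \<psi> x \<in> V (G div p ^ e) \<and> \<psi> x \<noteq> \<zero>"
begin

abbreviation Hom :: "nat \<Rightarrow> ('a \<Rightarrow> 'a) set" where
  "Hom e \<equiv> module_Hom S (Frobenius_pushforward S p e) (regular_module S)"

lemma Hom_premult:
  assumes "\<phi> \<in> Hom e" "r \<in> carrier S"
  shows "(\<lambda>x. \<phi> (r \<otimes> x)) \<in> Hom e"
proof -
  have "\<phi> (r \<otimes> (s [^] (p ^ e) \<otimes> x)) = s \<otimes> \<phi> (r \<otimes> x)" if "s \<in> carrier S" "x \<in> carrier S" for s x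
    using that assms m_lcomm[of r "s [^] (p ^ e)" x] by (simp add: module_Hom_Frobenius_iff)
  then show ?thesis using assms unfolding module_Hom_Frobenius_iff by (auto simp: r_distr Pi_iff)
qed

text \<open>Since maps may be premultiplied by ring elements, the set of all \<open>x\<close> that every map sends into \<open>I\<close>
is itself an ideal, so it suffices to check generators.\<close>

lemma Hom_image_Idl:
  assumes I: "ideal I S" and Z: "Z \<subseteq> carrier S"
    and *: "\<And>z \<psi>. z \<in> Z \<Longrightarrow> \<psi> \<in> Hom e \<Longrightarrow> \<psi> z \<in> I"
    and \<phi>: "\<phi> \<in> Hom e" and x: "x \<in> Idl Z"
  shows "\<phi> x \<in> I"
proof -
  interpret I: ideal I S by fact
  define K where "K = {x \<in> carrier S. \<forall>\<psi>\<in>Hom e. \<psi> x \<in> I}"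
  have mem: "\<psi> (r \<otimes> x) \<in> I" if "x \<in> K" "r \<in> carrier S" "\<psi> \<in> Hom e" for x r \<psi>
    using Hom_premult[OF that(3,2)] that(1) by (auto simp: K_def)
  have plus: "x \<oplus> y \<in> K" if "x \<in> K" "y \<in> K" for x y
    using that I.a_closed by (auto simp: K_def module_Hom_Frobenius_iff)
  have mult: "r \<otimes> x \<in> K" if "x \<in> K" "r \<in> carrier S" for x r
    using mem[OF that] that by (auto simp: K_def)
  have zero: "\<zero> \<in> K"
  proof -
    have "\<psi> \<zero> \<in> I" if "\<psi> \<in> Hom e" for \<psi>
    proof -
      have "\<psi> \<zero> \<oplus> \<psi> \<zero> = \<psi> \<zero>" using that unfolding module_Hom_Frobenius_iff by (metis l_zero zero_closed)
      moreover have "\<psi> \<zero> \<in> carrier S" using that unfolding module_Hom_Frobenius_iff by auto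
      ultimately have "\<psi> \<zero> = \<zero>" by (metis add.l_cancel_one)
      then show ?thesis by simp
    qed
    then show ?thesis by (simp add: K_def)
  qed
  have "ideal K S"
  proof (rule idealI)
    show "ring S" by (rule ring_axioms)
    show "subgroup K (add_monoid S)"
    proof (rule add.subgroupI)
      show "K \<subseteq> carrier S" by (auto simp: K_def)
      show "K \<noteq> {}" using zero by auto
      fix a assume a: "a \<in> K"
      then have "a \<in> carrier S" by (simp add: K_def)
      then have "\<ominus> a = (\<ominus> \<one>) \<otimes> a" by (simp add: l_minus)
      then show "\<ominus> a \<in> K" using mult[OF a, of "\<ominus> \<one>"] by simp
      show "a \<oplus> b \<in> K" if "b \<in> K" for b using plus[OF a that] .
    qed
    show "r \<otimes> a \<in> K" if "a \<in> K" "r \<in> carrier S" for a r using mult that by auto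
    show "a \<otimes> r \<in> K" if "a \<in> K" "r \<in> carrier S" for a r
      using mult[OF that] that by (metis (lifting) K_def m_comm mem_Collect_eq)
  qed
  moreover have "Z \<subseteq> K" using * Z by (auto simp: K_def)
  ultimately have "Idl Z \<subseteq> K" by (rule genideal_minimal)
  then show ?thesis using x \<phi> by (auto simp: K_def)
qed

lemma colon_ideal:
  assumes I: "ideal I S" and Y: "Y \<subseteq> carrier S"
  shows "ideal {x \<in> carrier S. \<forall>y\<in>Y. x \<otimes> y \<in> I} S"
proof (rule idealI)
  interpret I: ideal I S by fact
  show "ring S" by (rule ring_axioms)
  show "subgroup {x \<in> carrier S. \<forall>y\<in>Y. x \<otimes> y \<in> I} (add_monoid S)"
  proof (rule add.subgroupI)
    have "\<zero> \<in> {x \<in> carrier S. \<forall>y\<in>Y. x \<otimes> y \<in> I}" using Y by auto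
    then show "{x \<in> carrier S. \<forall>y\<in>Y. x \<otimes> y \<in> I} \<noteq> {}" by blast
  qed (use Y in \<open>auto simp: l_minus l_distr subset_iff\<close>)
  fix a x assume a: "a \<in> {x \<in> carrier S. \<forall>y\<in>Y. x \<otimes> y \<in> I}" and x: "x \<in> carrier S"
  then show *: "x \<otimes> a \<in> {x \<in> carrier S. \<forall>y\<in>Y. x \<otimes> y \<in> I}"
    using Y by (auto simp: m_assoc subset_iff I.I_l_closed)
  have "a \<otimes> x = x \<otimes> a" using a x by (auto intro: m_comm)
  then show "a \<otimes> x \<in> {x \<in> carrier S. \<forall>y\<in>Y. x \<otimes> y \<in> I}" using * by simp
qed

text \<open>Apply \<open>colon_ideal\<close> twice, once in each factor.\<close>

lemma Idl_mult:
  assumes I: "ideal I S" and A: "A \<subseteq> carrier S" and B: "B \<subseteq> carrier S"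
    and *: "\<And>x y. x \<in> A \<Longrightarrow> y \<in> B \<Longrightarrow> x \<otimes> y \<in> I"
    and x: "x \<in> Idl A" and y: "y \<in> Idl B"
  shows "x \<otimes> y \<in> I"
proof -
  have *: "x \<otimes> y \<in> I" if "x \<in> Idl A" "y \<in> B" for x y
    using genideal_minimal[OF colon_ideal[OF I B], of A] * A that by blast
  have IA: "Idl A \<subseteq> carrier S"
    using genideal_ideal[OF A] ideal.Icarr by fastforce
  have "B \<subseteq> {y \<in> carrier S. \<forall>x\<in>Idl A. y \<otimes> x \<in> I}"
    using * B IA m_comm by (fastforce simp: subset_iff)
  from genideal_minimal[OF colon_ideal[OF I IA] this] x y
  have "y \<otimes> x \<in> I" "y \<in> carrier S" by auto
  then show ?thesis using IA x m_comm by (metis subsetD)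
qed

definition generated_in :: "nat \<Rightarrow> 'a set \<Rightarrow> bool" where
  "generated_in n I \<longleftrightarrow> ideal I S \<and> I \<subseteq> Idl (I \<inter> V n)"

lemma Idl_Int_V_subset: "ideal I S \<Longrightarrow> Idl (I \<inter> V n) \<subseteq> I"
  by (rule genideal_minimal) auto

lemma generated_in_Idl: "ideal I S \<Longrightarrow> generated_in n (Idl (I \<inter> V n))"
proof -
  assume I: "ideal I S"
  have "I \<inter> V n \<subseteq> carrier S" using V_carrier by auto
  then have "ideal (Idl (I \<inter> V n)) S" "I \<inter> V n \<subseteq> Idl (I \<inter> V n) \<inter> V n"
    using genideal_ideal genideal_self by auto
  moreover have "Idl (I \<inter> V n) \<inter> V n \<subseteq> carrier S" using V_carrier by auto
  ultimately show ?thesis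
    unfolding generated_in_def using subset_Idl_subset by blast
qed

text \<open>Products of generators generate the product, and their gauges add up.\<close>

lemma ideal_prod_generated_in:
  assumes "generated_in m I" "generated_in n J"
  shows "generated_in (m + n) (ideal_prod S I J)"
proof -
  have I: "ideal I S" "I \<subseteq> Idl (I \<inter> V m)" and J: "ideal J S" "J \<subseteq> Idl (J \<inter> V n)"
    using assms by (auto simp: generated_in_def)
  let ?P = "ideal_prod S I J"
  have P: "ideal ?P S" by (rule ideal_prod_is_ideal[OF I(1) J(1)])
  have sub: "?P \<inter> V (m + n) \<subseteq> carrier S" using V_carrier by auto
  have Q: "ideal (Idl (?P \<inter> V (m + n))) S" by (rule genideal_ideal[OF sub])
  have mult: "x \<otimes> y \<in> Idl (?P \<inter> V (m + n))" if "x \<in> I" "y \<in> J" for x y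
  proof (rule Idl_mult[OF Q])
    show "I \<inter> V m \<subseteq> carrier S" "J \<inter> V n \<subseteq> carrier S" using V_carrier by auto
    show "x \<in> Idl (I \<inter> V m)" "y \<in> Idl (J \<inter> V n)" using that I J by auto
    fix a b assume "a \<in> I \<inter> V m" "b \<in> J \<inter> V n"
    then have "a \<otimes> b \<in> ?P \<inter> V (m + n)" using V_mult ideal_prod.prod by fastforce
    then show "a \<otimes> b \<in> Idl (?P \<inter> V (m + n))" using genideal_self[OF sub] by auto
  qed
  have "x \<in> Idl (?P \<inter> V (m + n))" if "x \<in> ?P" for x
    using that
  proof induction
    case (prod i j) then show ?case using mult by auto
  next
    case (sum s t) then show ?case
      using additive_subgroup.a_closed[OF ideal.axioms(1)[OF Q]] by blast
  qed
  then show ?thesis using P by (auto simp: generated_in_def)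
qed

lemma power_generated_in:
  assumes "generated_in d I"
  shows "generated_in (m * d) (I [^]\<^bsub>ideals_set S\<^esub> m)"
proof (induction m)
  case 0
  have sub: "carrier S \<inter> V 0 \<subseteq> carrier S" by auto
  have "\<one> \<in> Idl (carrier S \<inter> V 0)" using genideal_self[OF sub] V_one by auto
  then have "Idl (carrier S \<inter> V 0) = carrier S"
    by (rule ideal.one_imp_carrier[OF genideal_ideal[OF sub]])
  then show ?case by (simp add: generated_in_def ideals_set_def nat_pow_def oneideal)
next
  case (Suc m)
  then show ?case using ideal_prod_generated_in[OF Suc assms]
    by (simp add: ideals_set_def nat_pow_def add.commute)
qed

lemma exists_generated_in:
  assumes "ideal I S"
  shows "\<exists>d. generated_in d I"
proof -
  obtain F where F: "finite F" "F \<subseteq> I" "I \<subseteq> Idl F" using fin_gen[OF assms] by auto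
  have "\<exists>d. F \<subseteq> V d" using F(1,2)
  proof (induction F)
    case (insert x F)
    then obtain d where d: "F \<subseteq> V d" by auto
    obtain n where "x \<in> V n" using insert V_exhaust assms ideal.Icarr by (metis insert_subset)
    then have "insert x F \<subseteq> V (max d n)" using d V_mono[of d "max d n"] V_mono[of n "max d n"] by auto
    then show ?case by blast
  qed auto
  then obtain d where "F \<subseteq> V d" by auto
  then have "F \<subseteq> I \<inter> V d" using F by auto
  moreover have "I \<inter> V d \<subseteq> carrier S" using V_carrier by auto
  ultimately have "Idl F \<subseteq> Idl (I \<inter> V d)" using subset_Idl_subset by blast
  then show ?thesis using F assms by (auto simp: generated_in_def)
qed

text \<open>In a domain the zero ideal is the only minimal prime.\<close>

lemma in_no_minimal_prime_iff:
  assumes "ideal I S"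
  shows "in_no_minimal_prime S I \<longleftrightarrow> I \<noteq> {\<zero>}"
proof -
  have z: "primeideal {\<zero>} S" by (rule zeroprimeideal)
  have I0: "\<zero> \<in> I" using assms additive_subgroup.zero_closed ideal_def by blast
  have min: "minimal_prime S P \<longleftrightarrow> P = {\<zero>}" for P
  proof
    assume P: "minimal_prime S P"
    then have "ideal P S" using minimal_prime_def primeideal.axioms(1) by blast
    then have "\<zero> \<in> P" using additive_subgroup.zero_closed ideal_def by blast
    then show "P = {\<zero>}" using P z unfolding minimal_prime_def by auto
  next
    assume "P = {\<zero>}"
    moreover have "\<zero> \<in> Q" if "primeideal Q S" for Q
      using that primeideal.axioms(1) additive_subgroup.zero_closed ideal_def by blast
    ultimately show "minimal_prime S P" using z unfolding minimal_prime_def by auto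
  qed
  show ?thesis unfolding in_no_minimal_prime_def min using I0 by auto
qed

lemma ideal_prod_mono: "J \<subseteq> J' \<Longrightarrow> ideal_prod S I J \<subseteq> ideal_prod S I J'"
proof
  fix x assume J: "J \<subseteq> J'" and "x \<in> ideal_prod S I J"
  from this(2) show "x \<in> ideal_prod S I J'"
    by induction (use J in \<open>auto intro: ideal_prod.intros\<close>)
qed

lemma power_nonzero_element:
  assumes "ideal I S" "generated_in d I" "I \<noteq> {\<zero>}"
  shows "\<exists>x. x \<in> I [^]\<^bsub>ideals_set S\<^esub> (m::nat) \<inter> V (m * d) \<and> x \<noteq> \<zero>"
proof -
  have "\<exists>a \<in> I \<inter> V d. a \<noteq> \<zero>"
  proof (rule ccontr)
    assume "\<not> ?thesis"
    then have "I \<inter> V d \<subseteq> {\<zero>}" by auto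
    then have "Idl (I \<inter> V d) \<subseteq> {\<zero>}" by (rule genideal_minimal[OF zeroideal])
    moreover have "\<zero> \<in> I" using assms additive_subgroup.zero_closed ideal_def by blast
    ultimately show False using assms by (auto simp: generated_in_def)
  qed
  then obtain a where a: "a \<in> I" "a \<in> V d" "a \<noteq> \<zero>" by auto
  have ac: "a \<in> carrier S" using a V_carrier by auto
  show ?thesis
  proof (induction m)
    case 0
    show ?case using V_one by (intro exI[of _ \<one>]) (auto simp: ideals_set_def nat_pow_def)
  next
    case (Suc m)
    then obtain x where x: "x \<in> I [^]\<^bsub>ideals_set S\<^esub> m" "x \<in> V (m * d)" "x \<noteq> \<zero>" by auto
    then have "x \<otimes> a \<in> I [^]\<^bsub>ideals_set S\<^esub> Suc m"
      using a ideal_prod.prod by (fastforce simp: ideals_set_def nat_pow_def)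
    moreover have "x \<otimes> a \<in> V (Suc m * d)" using V_mult[OF x(2) a(2)] by (simp add: add.commute)
    moreover have "x \<otimes> a \<noteq> \<zero>" using a x ac V_carrier integral_iff by blast
    ultimately show ?case by blast
  qed
qed

lemma exponent_estimate:
  fixes t :: real
  assumes "0 < t" "t \<le> real T" "0 < q"
  shows "nat \<lceil>t * (real q - 1)\<rceil> * d + N \<le> T * d * q + d + N"
proof -
  have q1: "real q - 1 \<ge> 0" using assms by simp
  have "t * (real q - 1) \<le> real T * real q" using assms q1 by (intro mult_mono) auto
  then have "nat \<lceil>t * (real q - 1)\<rceil> \<le> T * q"
    by (metis ceiling_mono ceiling_of_nat nat_int nat_mono of_nat_mult)
  then have "nat \<lceil>t * (real q - 1)\<rceil> * d \<le> T * q * d" by (rule mult_le_mono1)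
  moreover have "T * q * d = T * d * q" by simp
  ultimately show ?thesis by linarith
qed

text \<open>The degree bound behind discreteness. Let \<open>J'\<close> be the ideal generated by the elements of \<open>J\<close> of gauge
at most \<open>N\<close>. With \<open>q = p\<^sup>e\<close>, the ideal \<open>I\<^bsup>m\<^esup> J'\<close> for \<open>m = \<lceil>t (q - 1)\<rceil>\<close> is generated in gauge \<open>m d + N\<close>, and maps
that divide the gauge by \<open>q\<close> bring this down to at most \<open>t d + d + N / 2\<close>, which is at most \<open>N\<close> if
\<open>N\<close> is at least \<open>2 (t d + d)\<close>. So \<open>J'\<close> satisfies the stability condition defining candidates, and
minimality of \<open>J\<close> gives \<open>J = J'\<close>. The bound \<open>N\<close> depends on \<open>t\<close> only through an upper bound \<open>T\<close>.\<close>

lemma least_candidate_generated_in: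
  fixes t :: real
  assumes I: "generated_in d I" "I \<noteq> {\<zero>}" and t: "0 < t" "t \<le> real T"
    and J: "test_ideal_candidate S p I t J"
    and least: "\<And>J'. test_ideal_candidate S p I t J' \<Longrightarrow> J \<subseteq> J'"
  shows "generated_in (2 * (T * d + d + 1)) J"
proof -
  \<comment> \<open>The factor \<open>2\<close> absorbs \<open>N / q\<close>, since \<open>q \<ge> 2\<close>; the summand \<open>1\<close> is for the element \<open>h\<close> below, whose
    gauge becomes at most \<open>1\<close> when divided by a large \<open>q\<close>.\<close>
  define N where "N = 2 * (T * d + d + 1)"
  define m where "m e = nat \<lceil>t * (real p ^ e - 1)\<rceil>" for e
  have pe: "0 < p ^ e" for e using p by simp
  have me: "m e * d + n \<le> T * d * p ^ e + d + n" for e n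
    using exponent_estimate[OF t pe[of e], of d n] by (simp add: m_def)
  have I': "ideal I S" using I by (simp add: generated_in_def)
  have Ji: "ideal J S" and J0: "J \<noteq> {\<zero>}"
    and stable: "\<And>e \<phi> x. 0 < e \<Longrightarrow> \<phi> \<in> Hom e \<Longrightarrow>
       x \<in> ideal_prod S (I [^]\<^bsub>ideals_set S\<^esub> m e) J \<Longrightarrow> \<phi> x \<in> J"
    using J in_no_minimal_prime_iff unfolding test_ideal_candidate_def m_def by blast+
  define J' where "J' = Idl (J \<inter> V N)"
  have J'J: "J' \<subseteq> J" and gen: "generated_in N J'" and J'i: "ideal J' S"
    using Idl_Int_V_subset[OF Ji] generated_in_Idl[OF Ji, of N] generated_in_def
    by (auto simp: J'_def)
  have JV: "J \<inter> V N \<subseteq> carrier S" using V_carrier by auto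
  have JVJ': "J \<inter> V N \<subseteq> J'" unfolding J'_def by (rule genideal_self[OF JV])
  have nonzero: "J' \<noteq> {\<zero>}"
  proof -
    \<comment> \<open>Any nonzero \<open>h \<in> J\<close> can be pushed down: for \<open>p\<^sup>e\<close> at least the gauge \<open>D\<close> of \<open>h\<close>, a suitable map
      sends \<open>a h\<close> with \<open>a \<in> I\<^bsup>m\<^esup>\<close> to a nonzero element whose gauge is bounded independently of \<open>h\<close>.\<close>
    have "\<zero> \<in> J" using Ji additive_subgroup.zero_closed ideal_def by blast
    then obtain h where h: "h \<in> J" "h \<noteq> \<zero>" using J0 by auto
    then obtain D where D: "h \<in> V D" using V_exhaust Ji ideal.Icarr by metis
    define e where "e = Suc D"
    have De: "D \<le> p ^ e"
    proof -
      have "D < 2 ^ D" by (rule less_exp)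
      also have "(2::nat) ^ D \<le> 2 ^ e" by (simp add: e_def)
      also have "(2::nat) ^ e \<le> p ^ e" using p by (rule power_mono) simp
      finally show ?thesis by simp
    qed
    obtain a where a: "a \<in> I [^]\<^bsub>ideals_set S\<^esub> m e" "a \<in> V (m e * d)" "a \<noteq> \<zero>"
      using power_nonzero_element[OF I' I] by blast
    have ah: "a \<otimes> h \<in> V (m e * d + D)" "a \<otimes> h \<noteq> \<zero>"
      using V_mult[OF a(2) D] a(3) h(2) integral_iff a(2) D V_carrier by blast+
    then obtain \<psi> where \<psi>: "\<psi> \<in> Hom e" "\<psi> (a \<otimes> h) \<in> V ((m e * d + D) div p ^ e)"
      "\<psi> (a \<otimes> h) \<noteq> \<zero>" using gauge_nonzero by blast
    have "(m e * d + D) div p ^ e \<le> T * d + d + 1"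
    proof -
      have "m e * d + D \<le> T * d * p ^ e + d + D" by (rule me)
      also have "\<dots> \<le> T * d * p ^ e + d * p ^ e + p ^ e" using De pe[of e] by (intro add_mono) auto
      also have "\<dots> = (T * d + d + 1) * p ^ e" by (simp add: algebra_simps)
      finally show ?thesis using pe[of e] by (metis div_le_mono div_mult_self_is_m)
    qed
    then have "(m e * d + D) div p ^ e \<le> N" by (simp add: N_def)
    then have "\<psi> (a \<otimes> h) \<in> V N" using \<psi>(2) V_mono by blast
    moreover have "\<psi> (a \<otimes> h) \<in> J"
      by (rule stable[OF _ \<psi>(1)]) (use a h in \<open>auto simp: e_def intro: ideal_prod.prod\<close>)
    ultimately show ?thesis using JVJ' \<psi>(3) by auto
  qed
  have "\<phi> x \<in> J'" if e: "0 < e" and \<phi>: "\<phi> \<in> Hom e"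
    and x: "x \<in> ideal_prod S (I [^]\<^bsub>ideals_set S\<^esub> m e) J'" for e \<phi> x
  proof -
    define P where "P = ideal_prod S (I [^]\<^bsub>ideals_set S\<^esub> m e) J'"
    define M where "M = m e * d + N"
    have P: "generated_in M P"
      unfolding P_def M_def by (rule ideal_prod_generated_in[OF power_generated_in[OF I(1)] gen])
    have MN: "M div p ^ e \<le> N"
    proof -
      have "p ^ 1 \<le> p ^ e" using p e by (intro power_increasing) auto
      then have q2: "2 \<le> p ^ e" using p by simp
      have "M \<le> T * d * p ^ e + d + N" unfolding M_def by (rule me)
      also have "\<dots> \<le> T * d * p ^ e + d * p ^ e + (T * d + d + 1) * p ^ e"
      proof (intro add_mono)
        show "d \<le> d * p ^ e" using mult_le_mono2[of 1 "p ^ e" d] pe[of e]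
          by (metis One_nat_def Suc_leI mult.right_neutral)
        show "N \<le> (T * d + d + 1) * p ^ e"
          unfolding N_def using mult_le_mono2[OF q2] by (metis mult.commute)
      qed simp
      also have "\<dots> = (T * d + d + (T * d + d + 1)) * p ^ e" by (simp add: algebra_simps)
      finally have "M div p ^ e \<le> T * d + d + (T * d + d + 1)"
        using pe[of e] by (metis div_le_mono div_mult_self_is_m)
      then show ?thesis by (simp add: N_def)
    qed
    \<comment> \<open>On generators \<open>z\<close> of gauge at most \<open>M\<close> the gauge bound applies; the values it uses lie in \<open>J\<close>
      because \<open>J\<close> is stable, and in \<open>V N\<close>, hence in \<open>J'\<close>.\<close>
    show ?thesis
    proof (rule Hom_image_Idl[OF J'i _ _ \<phi>])
      show "P \<inter> V M \<subseteq> carrier S" using V_carrier by auto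
      show "x \<in> Idl (P \<inter> V M)" using x P by (auto simp: generated_in_def P_def)
      fix z \<psi> assume z: "z \<in> P \<inter> V M" and \<psi>: "\<psi> \<in> Hom e"
      let ?Z = "{\<eta> z |\<eta>. \<eta> \<in> Hom e \<and> \<eta> z \<in> V (M div p ^ e)}"
      have "?Z \<subseteq> J \<inter> V N"
      proof safe
        fix \<eta> assume \<eta>: "\<eta> \<in> Hom e" "\<eta> z \<in> V (M div p ^ e)"
        have "z \<in> ideal_prod S (I [^]\<^bsub>ideals_set S\<^esub> m e) J"
          using z ideal_prod_mono[OF J'J] by (auto simp: P_def)
        then show "\<eta> z \<in> J" by (rule stable[OF e \<eta>(1)])
        show "\<eta> z \<in> V N" using \<eta>(2) V_mono[OF MN] by auto
      qed
      then have "Idl ?Z \<subseteq> J'" using genideal_minimal[OF J'i] JVJ' by blast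
      then show "\<psi> z \<in> J'" using gauge_bound[OF \<psi>, of z M] z by auto
    qed
  qed
  then have "test_ideal_candidate S p I t J'"
    using J'i nonzero in_no_minimal_prime_iff unfolding test_ideal_candidate_def m_def by blast
  then have "J = J'" using least J'J by blast
  then show ?thesis using gen by (simp add: N_def)
qed

text \<open>By definition test ideals decrease strictly from one jumping coefficient to a larger one. Those for
\<open>t \<le> T\<close> are determined by their traces on the same \<open>V N\<close>, and these traces form a chain, so there are
only finitely many.\<close>

theorem finite_F_jumping_coefficients:
  assumes I: "ideal I S" "in_no_minimal_prime S I"
  shows "finite {t. F_jumping_coefficient S p I t \<and> t \<le> real T}"
proof -
  let ?\<tau> = "test_ideal S p I"
  let ?A = "{t. F_jumping_coefficient S p I t \<and> t \<le> real T}"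
  let ?least = "\<lambda>t J. test_ideal_candidate S p I t J \<and> (\<forall>J'. test_ideal_candidate S p I t J' \<longrightarrow> J \<subseteq> J')"
  have I0: "I \<noteq> {\<zero>}" using I in_no_minimal_prime_iff by auto
  obtain d where d: "generated_in d I" using exists_generated_in[OF I(1)] by auto
  define N where "N = 2 * (T * d + d + 1)"
  have strict: "?\<tau> t \<subset> ?\<tau> s" if "t \<in> ?A" "s \<in> ?A" "s < t" for s t
  proof -
    have "\<forall>\<epsilon>. 0 < \<epsilon> \<and> \<epsilon> < t \<longrightarrow> ?\<tau> t \<subset> ?\<tau> (t - \<epsilon>)" "0 < s"
      using that by (auto simp: F_jumping_coefficient_def)
    then have "0 < t - s \<and> t - s < t \<longrightarrow> ?\<tau> t \<subset> ?\<tau> (t - (t - s))" "0 < s" by blast+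
    then show ?thesis using that(3) by simp
  qed
  define A where "A = {t \<in> ?A. \<exists>J. ?least t J}"
  have \<tau>_gen: "generated_in N (?\<tau> t)" if t: "t \<in> A" for t
  proof -
    obtain J where J: "?least t J" using t by (auto simp: A_def)
    then have "?\<tau> t = J" unfolding test_ideal_def by (intro the_equality) (auto intro: subset_antisym)
    moreover have "0 < t" "t \<le> real T" using t by (auto simp: A_def F_jumping_coefficient_def)
    ultimately show ?thesis unfolding N_def
      using least_candidate_generated_in[OF d I0 _ _ conjunct1[OF J]] J by blast
  qed
  have "inj_on (\<lambda>t. ?\<tau> t \<inter> V N) A"
  proof (rule linorder_inj_onI')
    fix s t assume st: "s \<in> A" "t \<in> A" "s < t"
    then have "?\<tau> t \<subset> ?\<tau> s" using strict by (auto simp: A_def)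
    moreover have "?\<tau> s = Idl (?\<tau> s \<inter> V N)" "?\<tau> t = Idl (?\<tau> t \<inter> V N)"
      using \<tau>_gen[OF st(1)] \<tau>_gen[OF st(2)] Idl_Int_V_subset
      by (simp_all add: generated_in_def subset_antisym)
    ultimately show "?\<tau> s \<inter> V N \<noteq> ?\<tau> t \<inter> V N" by auto
  qed
  moreover have "finite ((\<lambda>t. ?\<tau> t \<inter> V N) ` A)"
  proof (rule finite_chain)
    fix W assume "W \<in> (\<lambda>t. ?\<tau> t \<inter> V N) ` A"
    then show "\<exists>J. ideal J S \<and> W = J \<inter> V N" using \<tau>_gen by (auto simp: generated_in_def)
  next
    fix W W' assume "W \<in> (\<lambda>t. ?\<tau> t \<inter> V N) ` A" "W' \<in> (\<lambda>t. ?\<tau> t \<inter> V N) ` A"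
    then obtain s t where st: "s \<in> A" "t \<in> A" "W = ?\<tau> s \<inter> V N" "W' = ?\<tau> t \<inter> V N" by auto
    then have "?\<tau> s \<subseteq> ?\<tau> t \<or> ?\<tau> t \<subseteq> ?\<tau> s"
      using strict[of s t] strict[of t s] by (cases s t rule: linorder_cases) (auto simp: A_def)
    then show "W \<subseteq> W' \<or> W' \<subseteq> W" using st by auto
  qed
  ultimately have "finite A" by (rule finite_imageD[rotated])
  moreover have "finite (?A - A)"
  proof -
    \<comment> \<open>The value of \<open>test_ideal\<close> at a parameter without a least candidate does not depend on the
      parameter, so by strictness at most one jumping coefficient is of this kind.\<close>
    have "?\<tau> t = The (\<lambda>_. False)" if "t \<in> ?A - A" for t
    proof -
      have "(\<lambda>J. ?least t J) = (\<lambda>_. False)" using that by (auto simp: A_def fun_eq_iff)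
      then show ?thesis unfolding test_ideal_def by metis
    qed
    then have eq: "s = t" if "s \<in> ?A - A" "t \<in> ?A - A" for s t
      using that strict[of s t] strict[of t s] by (cases s t rule: linorder_cases) auto
    show ?thesis
    proof (cases "?A - A = {}")
      case False
      then obtain s where "s \<in> ?A - A" by blast
      then have "?A - A \<subseteq> {s}" using eq by blast
      then show ?thesis by (rule finite_subset) simp
    qed (metis finite.emptyI)
  qed
  ultimately show ?thesis using finite_Diff2 by blast
qed

lemma discrete_F_jumping_coefficients:
  assumes I: "ideal I S" "in_no_minimal_prime S I"
  shows "\<not> x islimpt {t. F_jumping_coefficient S p I t}"
proof
  let ?F = "{t. F_jumping_coefficient S p I t}"
  assume "x islimpt ?F"
  obtain T where T: "x + 1 \<le> real T" using real_arch_simple by blast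
  have "?F = (?F \<inter> {..<x + 1}) \<union> (?F \<inter> {x + 1..})" by auto
  moreover have "\<not> x islimpt (?F \<inter> {x + 1..})"
    using islimpt_subset[of x "?F \<inter> {x + 1..}" "{x + 1..}"] closed_limpt[of "{x + 1..}"] by auto
  ultimately have "x islimpt (?F \<inter> {..<x + 1})"
    using \<open>x islimpt ?F\<close> islimpt_Un by metis
  moreover have "?F \<inter> {..<x + 1} \<subseteq> {t. F_jumping_coefficient S p I t \<and> t \<le> real T}" using T by auto
  ultimately show False
    using finite_F_jumping_coefficients[OF I] islimpt_finite islimpt_subset by metis
qed

end

section \<open>Hilbert's basis theorem for subrings\<close>

text \<open>Ideals of a subring of an ambient commutative ring are treated as sets, so that rings can be enlarged
by one generator at a time within a single type.\<close>

definition unital_subring :: "'a::comm_ring_1 set \<Rightarrow> bool" where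
  "unital_subring R \<longleftrightarrow> 1 \<in> R \<and> (\<forall>x\<in>R. \<forall>y\<in>R. x - y \<in> R \<and> x * y \<in> R)"

definition ideal_of :: "'a::comm_ring_1 set \<Rightarrow> 'a set \<Rightarrow> bool" where
  "ideal_of R I \<longleftrightarrow> I \<subseteq> R \<and> 0 \<in> I \<and> (\<forall>a\<in>I. \<forall>b\<in>I. a + b \<in> I) \<and> (\<forall>x\<in>R. \<forall>a\<in>I. x * a \<in> I)"

text \<open>Finite generation of \<open>I\<close> is expressed by the property that any ideal containing the finite set \<open>F\<close>
contains \<open>I\<close>.\<close>

definition noetherian_subring :: "'a::comm_ring_1 set \<Rightarrow> bool" where
  "noetherian_subring R \<longleftrightarrow> unital_subring R \<and>
     (\<forall>I. ideal_of R I \<longrightarrow> (\<exists>F. finite F \<and> F \<subseteq> I \<and> (\<forall>J. ideal_of R J \<and> F \<subseteq> J \<longrightarrow> I \<subseteq> J)))"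

lemma ideal_ofD:
  assumes "ideal_of R I"
  shows "a \<in> I \<Longrightarrow> a \<in> R" "0 \<in> I" "a \<in> I \<Longrightarrow> b \<in> I \<Longrightarrow> a + b \<in> I" "x \<in> R \<Longrightarrow> a \<in> I \<Longrightarrow> x * a \<in> I"
  using assms unfolding ideal_of_def by blast+

lemma unital_subringD:
  assumes "unital_subring R"
  shows "1 \<in> R" "0 \<in> R" "x \<in> R \<Longrightarrow> - x \<in> R" "x \<in> R \<Longrightarrow> y \<in> R \<Longrightarrow> x + y \<in> R"
    "x \<in> R \<Longrightarrow> y \<in> R \<Longrightarrow> x - y \<in> R" "x \<in> R \<Longrightarrow> y \<in> R \<Longrightarrow> x * y \<in> R"
proof -
  show 1: "1 \<in> R" and m: "\<And>x y. x \<in> R \<Longrightarrow> y \<in> R \<Longrightarrow> x - y \<in> R"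
    and "x \<in> R \<Longrightarrow> y \<in> R \<Longrightarrow> x * y \<in> R"
    using assms by (auto simp: unital_subring_def)
  show 0: "0 \<in> R" using m[OF 1 1] by simp
  show neg: "- x \<in> R" if "x \<in> R" for x using m[OF 0 that] by simp
  show "x \<in> R \<Longrightarrow> y \<in> R \<Longrightarrow> x + y \<in> R" using m[OF _ neg, of x y] by simp
qed

lemma unital_subring_sum:
  assumes "unital_subring R" "\<And>i. i \<in> A \<Longrightarrow> f i \<in> R"
  shows "sum f A \<in> R"
  using assms(2)
  by (induction A rule: infinite_finite_induct) (auto simp: unital_subringD[OF assms(1)])

lemma noetherian_subring_field:
  assumes R: "unital_subring R" and inv: "\<And>x. x \<in> R \<Longrightarrow> x \<noteq> 0 \<Longrightarrow> \<exists>y\<in>R. y * x = 1"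
  shows "noetherian_subring R"
  unfolding noetherian_subring_def
proof (intro conjI allI impI R)
  fix I assume I: "ideal_of R I"
  show "\<exists>F. finite F \<and> F \<subseteq> I \<and> (\<forall>J. ideal_of R J \<and> F \<subseteq> J \<longrightarrow> I \<subseteq> J)"
  proof (cases "I \<subseteq> {0}")
    case True
    then show ?thesis by (intro exI[of _ "{}"]) (auto simp: ideal_of_def)
  next
    case False
    then obtain a where a: "a \<in> I" "a \<noteq> 0" by auto
    then obtain b where b: "b \<in> R" "b * a = 1" using inv ideal_ofD(1)[OF I] by blast
    have "x \<in> J" if "ideal_of R J" "a \<in> J" "x \<in> I" for J x
    proof -
      have "b * a \<in> J" using that b ideal_ofD(4)[OF that(1)] by blast
      then have "x * 1 \<in> J" using ideal_ofD(4)[OF that(1)] ideal_ofD(1)[OF I that(3)] b by metis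
      then show ?thesis by simp
    qed
    then show ?thesis using a by (intro exI[of _ "{a}"]) auto
  qed
qed

definition adjoin :: "'a::comm_ring_1 set \<Rightarrow> 'a \<Rightarrow> 'a set" where
  "adjoin R y = {poly q y |q. \<forall>i. Polynomial.coeff q i \<in> R}"

lemma unital_subring_adjoin:
  assumes R: "unital_subring R"
  shows "unital_subring (adjoin R y)"
  unfolding unital_subring_def
proof (intro conjI ballI)
  show "1 \<in> adjoin R y" unfolding adjoin_def
    by (intro CollectI exI[of _ 1]) (simp add: coeff_1 unital_subringD[OF R])
next
  fix f g assume "f \<in> adjoin R y" "g \<in> adjoin R y"
  then obtain q r where q: "f = poly q y" "\<forall>i. Polynomial.coeff q i \<in> R" and r: "g = poly r y" "\<forall>i. Polynomial.coeff r i \<in> R"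
    by (auto simp: adjoin_def)
  show "f - g \<in> adjoin R y" unfolding adjoin_def q r
    by (intro CollectI exI[of _ "q - r"]) (simp add: unital_subringD[OF R] q r)
  show "f * g \<in> adjoin R y" unfolding adjoin_def q r
    by (intro CollectI exI[of _ "q * r"])
      (auto simp: coeff_mult q r intro!: unital_subring_sum[OF R] unital_subringD[OF R])
qed

lemma adjoin_superset:
  assumes R: "unital_subring R"
  shows "R \<subseteq> adjoin R y" "y \<in> adjoin R y"
proof -
  show "R \<subseteq> adjoin R y"
  proof
    fix x assume "x \<in> R"
    then show "x \<in> adjoin R y" unfolding adjoin_def
      by (intro CollectI exI[of _ "[:x:]"]) (auto simp: coeff_pCons unital_subringD[OF R] split: nat.split)
  qed
  show "y \<in> adjoin R y" unfolding adjoin_def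
    by (intro CollectI exI[of _ "[:0, 1:]"]) (auto simp: coeff_pCons unital_subringD[OF R] split: nat.split)
qed

lemma adjoin_least:
  assumes Z: "unital_subring Z" and "R \<subseteq> Z" "y \<in> Z"
  shows "adjoin R y \<subseteq> Z"
proof
  have pow: "y ^ i \<in> Z" for i by (induction i) (auto simp: unital_subringD[OF Z] assms)
  fix f assume "f \<in> adjoin R y"
  then obtain q where "f = poly q y" "\<forall>i. Polynomial.coeff q i \<in> R" by (auto simp: adjoin_def)
  then show "f \<in> Z" using assms pow
    by (auto simp: poly_altdef intro!: unital_subring_sum[OF Z] unital_subringD[OF Z])
qed

text \<open>The generator \<open>y\<close> may satisfy relations over \<open>R\<close>, so an element of \<open>adjoin R y\<close> has no degree of its
own; the coefficients of \<open>y\<^sup>n\<close> are collected over all polynomial expressions of degree at most \<open>n\<close>.\<close>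

definition leading_coeffs :: "'a::comm_ring_1 set \<Rightarrow> 'a \<Rightarrow> 'a set \<Rightarrow> nat \<Rightarrow> 'a set" where
  "leading_coeffs R y I n =
     {Polynomial.coeff q n |q. (\<forall>i. Polynomial.coeff q i \<in> R) \<and> Polynomial.degree q \<le> n \<and> poly q y \<in> I}"

lemma ideal_of_leading_coeffs:
  assumes R: "unital_subring R" and I: "ideal_of (adjoin R y) I"
  shows "ideal_of R (leading_coeffs R y I n)"
  unfolding ideal_of_def
proof (intro conjI ballI)
  show "leading_coeffs R y I n \<subseteq> R" by (auto simp: leading_coeffs_def)
  show "0 \<in> leading_coeffs R y I n" unfolding leading_coeffs_def
    using I by (intro CollectI exI[of _ 0]) (auto simp: unital_subringD[OF R] ideal_of_def)
next
  fix a b assume "a \<in> leading_coeffs R y I n" "b \<in> leading_coeffs R y I n"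
  then obtain q r where q: "a = Polynomial.coeff q n" "\<forall>i. Polynomial.coeff q i \<in> R" "Polynomial.degree q \<le> n" "poly q y \<in> I"
    and r: "b = Polynomial.coeff r n" "\<forall>i. Polynomial.coeff r i \<in> R" "Polynomial.degree r \<le> n" "poly r y \<in> I"
    by (auto simp: leading_coeffs_def)
  then show "a + b \<in> leading_coeffs R y I n" unfolding leading_coeffs_def
    using I by (intro CollectI exI[of _ "q + r"])
      (auto simp: unital_subringD[OF R] ideal_of_def degree_add_le)
next
  fix x a assume x: "x \<in> R" and "a \<in> leading_coeffs R y I n"
  then obtain q where q: "a = Polynomial.coeff q n" "\<forall>i. Polynomial.coeff q i \<in> R" "Polynomial.degree q \<le> n" "poly q y \<in> I"
    by (auto simp: leading_coeffs_def)
  have "x * poly q y \<in> I" using x q adjoin_superset(1)[OF R] ideal_ofD(4)[OF I] by blast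
  then show "x * a \<in> leading_coeffs R y I n" unfolding leading_coeffs_def
    using q x by (intro CollectI exI[of _ "Polynomial.smult x q"])
      (auto simp: unital_subringD[OF R] intro: order.trans[OF degree_smult_le])
qed

lemma leading_coeffs_Suc:
  assumes R: "unital_subring R" and I: "ideal_of (adjoin R y) I"
  shows "leading_coeffs R y I n \<subseteq> leading_coeffs R y I (Suc n)"
proof
  fix a assume "a \<in> leading_coeffs R y I n"
  then obtain q where q: "a = Polynomial.coeff q n" "\<forall>i. Polynomial.coeff q i \<in> R" "Polynomial.degree q \<le> n" "poly q y \<in> I"
    by (auto simp: leading_coeffs_def)
  have "y * poly q y \<in> I" using q adjoin_superset(2)[OF R] ideal_ofD(4)[OF I] by blast
  then show "a \<in> leading_coeffs R y I (Suc n)" unfolding leading_coeffs_def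
    using q by (intro CollectI exI[of _ "pCons 0 q"])
      (auto simp: unital_subringD[OF R] coeff_pCons degree_pCons_le split: nat.split
        intro: order.trans[OF degree_pCons_le])
qed

text \<open>Equal leading coefficients allow the top term of an expression for an element of \<open>I\<close> to be cancelled by
an element of \<open>I \<inter> J\<close>; induct on the degree of the expression.\<close>

lemma ideal_eq_if_leading_coeffs_eq:
  assumes R: "unital_subring R" and I: "ideal_of (adjoin R y) I" and J: "ideal_of (adjoin R y) J"
    and lead: "\<And>n. leading_coeffs R y I n \<subseteq> leading_coeffs R y (I \<inter> J) n"
  shows "I \<subseteq> J"
proof -
  have sub: "unital_subring (adjoin R y)" by (rule unital_subring_adjoin[OF R])
  have "poly q y \<in> J" if "\<forall>i. Polynomial.coeff q i \<in> R" "Polynomial.degree q \<le> n" "poly q y \<in> I" for q n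
    using that
  proof (induction n arbitrary: q rule: less_induct)
    case (less n)
    then have "Polynomial.coeff q n \<in> leading_coeffs R y (I \<inter> J) n"
      using lead[of n] unfolding leading_coeffs_def by blast
    then obtain r where r: "Polynomial.coeff q n = Polynomial.coeff r n" "\<forall>i. Polynomial.coeff r i \<in> R" "Polynomial.degree r \<le> n"
      "poly r y \<in> I" "poly r y \<in> J" by (auto simp: leading_coeffs_def)
    have cX: "\<forall>i. Polynomial.coeff (q - r) i \<in> R" using less r by (auto simp: unital_subringD[OF R])
    have "- 1 * poly r y \<in> I"
      using unital_subringD(3)[OF sub unital_subringD(1)[OF sub]] r(4) ideal_ofD(4)[OF I] by blast
    then have "poly q y + - 1 * poly r y \<in> I" using I less by (auto simp: ideal_of_def)
    then have inI: "poly (q - r) y \<in> I" by simp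
    have "poly (q - r) y \<in> J"
    proof (cases "q - r = 0")
      case True
      then show ?thesis using J by (simp add: ideal_of_def)
    next
      case False
      have "Polynomial.degree (q - r) \<le> n" using less r by (simp add: degree_diff_le)
      moreover have "Polynomial.degree (q - r) \<noteq> n" using False r leading_coeff_0_iff[of "q - r"] by auto
      ultimately have "Polynomial.degree (q - r) < n" by simp
      then show ?thesis using less.IH[OF _ cX order.refl inI] by simp
    qed
    then have "poly (q - r) y + poly r y \<in> J" using ideal_ofD(3)[OF J] r by blast
    then show ?case by simp
  qed
  note * = this
  show ?thesis
  proof
    fix f assume f: "f \<in> I"
    then obtain q where "f = poly q y" "\<forall>i. Polynomial.coeff q i \<in> R"
      using ideal_ofD(1)[OF I] unfolding adjoin_def by blast
    then show "f \<in> J" using *[of q "Polynomial.degree q"] f by simp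
  qed
qed

text \<open>The ideals of leading coefficients increase with the degree and become stationary at some \<open>N\<close>. Finitely
many elements of \<open>I\<close> realize generators of the first \<open>N + 1\<close> of them; an ideal \<open>J\<close> containing these
elements has the property that \<open>I\<close> and \<open>I \<inter> J\<close> have the same leading coefficients in every degree.\<close>

theorem Hilbert_basis:
  assumes R: "noetherian_subring R"
  shows "noetherian_subring (adjoin R y)"
  unfolding noetherian_subring_def
proof (intro conjI allI impI)
  have sub: "unital_subring R" using R by (simp add: noetherian_subring_def)
  have fg: "\<exists>F. finite F \<and> F \<subseteq> I \<and> (\<forall>J. ideal_of R J \<and> F \<subseteq> J \<longrightarrow> I \<subseteq> J)" if "ideal_of R I" for I
    using R that by (simp add: noetherian_subring_def)
  show "unital_subring (adjoin R y)" by (rule unital_subring_adjoin[OF sub])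
  fix I assume I: "ideal_of (adjoin R y) I"
  define L where "L = leading_coeffs R y I"
  have L: "ideal_of R (L n)" for n unfolding L_def by (rule ideal_of_leading_coeffs[OF sub I])
  have mono: "m \<le> n \<Longrightarrow> L m \<subseteq> L n" for m n
    by (rule lift_Suc_mono_le) (auto simp: L_def leading_coeffs_Suc[OF sub I])
  have "ideal_of R (\<Union>n. L n)"
    unfolding ideal_of_def
  proof (intro conjI ballI)
    fix a b assume "a \<in> (\<Union>n. L n)" "b \<in> (\<Union>n. L n)"
    then obtain m n where "a \<in> L m" "b \<in> L n" by auto
    then have "a \<in> L (max m n)" "b \<in> L (max m n)"
      using mono[of m "max m n"] mono[of n "max m n"] by auto
    then show "a + b \<in> (\<Union>n. L n)" using ideal_ofD(3)[OF L] by auto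
  next
    fix x a assume x: "x \<in> R" and "a \<in> (\<Union>n. L n)"
    then obtain n where "a \<in> L n" by auto
    then show "x * a \<in> (\<Union>n. L n)" using ideal_ofD(4)[OF L x] by auto
  qed (use ideal_ofD(1,2)[OF L] in auto)
  then obtain F where F: "finite F" "F \<subseteq> (\<Union>n. L n)"
    and gen: "\<And>J. ideal_of R J \<Longrightarrow> F \<subseteq> J \<Longrightarrow> (\<Union>n. L n) \<subseteq> J"
    using fg[of "\<Union>n. L n"] by auto
  have "\<exists>N. F \<subseteq> L N" using F
  proof (induction F)
    case (insert x F)
    then obtain m n where mn: "F \<subseteq> L m" "x \<in> L n" by auto
    then have "insert x F \<subseteq> L (max m n)" using mono[of m "max m n"] mono[of n "max m n"] by auto
    then show ?case by blast
  qed auto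
  then obtain N where N: "F \<subseteq> L N" by auto
  then have stat: "L n \<subseteq> L N" for n using gen[OF L] by blast
  have "\<forall>n. \<exists>F. finite F \<and> F \<subseteq> L n \<and> (\<forall>J. ideal_of R J \<and> F \<subseteq> J \<longrightarrow> L n \<subseteq> J)"
    using fg L by blast
  then obtain H where H: "\<And>n. finite (H n)" "\<And>n. H n \<subseteq> L n"
    "\<And>n J. ideal_of R J \<Longrightarrow> H n \<subseteq> J \<Longrightarrow> L n \<subseteq> J" by metis
  have "\<forall>n. \<forall>c\<in>H n. \<exists>q. (\<forall>i. Polynomial.coeff q i \<in> R) \<and> Polynomial.degree q \<le> n \<and> poly q y \<in> I \<and> Polynomial.coeff q n = c"
    using H(2) by (fastforce simp: L_def leading_coeffs_def)
  then obtain Q where Q: "\<And>n c i. c \<in> H n \<Longrightarrow> Polynomial.coeff (Q n c) i \<in> R" "\<And>n c. c \<in> H n \<Longrightarrow> Polynomial.degree (Q n c) \<le> n"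
    "\<And>n c. c \<in> H n \<Longrightarrow> poly (Q n c) y \<in> I" "\<And>n c. c \<in> H n \<Longrightarrow> Polynomial.coeff (Q n c) n = c" by metis
  define G where "G = (\<Union>n\<in>{..N}. (\<lambda>c. poly (Q n c) y) ` H n)"
  have "I \<subseteq> J" if J: "ideal_of (adjoin R y) J" and GJ: "G \<subseteq> J" for J
  proof (rule ideal_eq_if_leading_coeffs_eq[OF sub I J])
    have IJ: "ideal_of (adjoin R y) (I \<inter> J)" using I J by (auto simp: ideal_of_def)
    define M where "M = leading_coeffs R y (I \<inter> J)"
    have low: "L n \<subseteq> M n" if "n \<le> N" for n
    proof (rule H(3))
      show "ideal_of R (M n)" unfolding M_def by (rule ideal_of_leading_coeffs[OF sub IJ])
      show "H n \<subseteq> M n"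
      proof
        fix c assume c: "c \<in> H n"
        then have "poly (Q n c) y \<in> I \<inter> J" using Q(3)[OF c] GJ that by (auto simp: G_def)
        then show "c \<in> M n" unfolding M_def leading_coeffs_def
          using Q[OF c] by (intro CollectI exI[of _ "Q n c"]) auto
      qed
    qed
    have high: "M N \<subseteq> M n" if "N \<le> n" for n
      using that by (rule lift_Suc_mono_le[rotated]) (auto simp: M_def leading_coeffs_Suc[OF sub IJ])
    have "L n \<subseteq> M n" for n
    proof (cases "n \<le> N")
      case True
      then show ?thesis by (rule low)
    next
      case False
      then show ?thesis using stat[of n] low[of N] high[of n] by simp
    qed
    then show "leading_coeffs R y I n \<subseteq> leading_coeffs R y (I \<inter> J) n" for n
      by (simp add: L_def M_def)
  qed
  moreover have "finite G" "G \<subseteq> I" using H(1) Q(3) by (auto simp: G_def)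
  ultimately show "\<exists>F. finite F \<and> F \<subseteq> I \<and> (\<forall>J. ideal_of (adjoin R y) J \<and> F \<subseteq> J \<longrightarrow> I \<subseteq> J)"
    by blast
qed

corollary noetherian_subring_finitely_generated:
  assumes R: "noetherian_subring R" and Y: "finite Y" and A: "unital_subring A" "R \<subseteq> A" "Y \<subseteq> A"
    and least: "\<And>Z. unital_subring Z \<Longrightarrow> R \<subseteq> Z \<Longrightarrow> Y \<subseteq> Z \<Longrightarrow> A \<subseteq> Z"
  shows "noetherian_subring A"
proof -
  have "\<exists>Z. noetherian_subring Z \<and> R \<subseteq> Z \<and> Y \<subseteq> Z \<and> Z \<subseteq> A" using Y A(3)
  proof (induction Y)
    case empty
    then show ?case using R A by auto
  next
    case (insert y Y)
    then obtain Z where Z: "noetherian_subring Z" "R \<subseteq> Z" "Y \<subseteq> Z" "Z \<subseteq> A" by auto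
    then have "unital_subring Z" by (simp add: noetherian_subring_def)
    then show ?case
      using Z insert.prems Hilbert_basis[OF Z(1), of y] adjoin_superset[of Z y] adjoin_least[OF A(1), of Z y]
      by (intro exI[of _ "adjoin Z y"]) auto
  qed
  then obtain Z where Z: "noetherian_subring Z" "R \<subseteq> Z" "Y \<subseteq> Z" "Z \<subseteq> A" by auto
  then have "A = Z" using least[of Z] by (auto simp: noetherian_subring_def)
  then show ?thesis using Z by simp
qed
section \<open>Chains of subspaces\<close>

text \<open>The dimension is strictly monotone on the chain and bounded.\<close>

lemma (in vector_space) finite_chain_of_subspaces:
  assumes E: "finite E"
    and sub: "\<And>W. W \<in> \<W> \<Longrightarrow> subspace W \<and> W \<subseteq> span E"
    and chain: "\<And>W W'. W \<in> \<W> \<Longrightarrow> W' \<in> \<W> \<Longrightarrow> W \<subseteq> W' \<or> W' \<subseteq> W"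
  shows "finite \<W>"
proof -
  have "\<forall>W\<in>\<W>. \<exists>B. B \<subseteq> W \<and> independent B \<and> span B = W"
  proof
    fix W assume W: "W \<in> \<W>"
    obtain B where B: "B \<subseteq> W" "independent B" "W \<subseteq> span B"
      by (rule maximal_independent_subset)
    moreover have "span B \<subseteq> W" by (rule span_minimal) (use sub[OF W] B in auto)
    ultimately show "\<exists>B. B \<subseteq> W \<and> independent B \<and> span B = W" by blast
  qed
  then obtain B where B: "\<And>W. W \<in> \<W> \<Longrightarrow> B W \<subseteq> W" "\<And>W. W \<in> \<W> \<Longrightarrow> independent (B W)"
    "\<And>W. W \<in> \<W> \<Longrightarrow> span (B W) = W" by metis
  have bound: "finite (B W) \<and> card (B W) \<le> card E" if "W \<in> \<W>" for W
    using independent_span_bound[OF E B(2)[OF that]] B(1)[OF that] sub[OF that] by blast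
  have less: "card (B W) < card (B W')" if "W \<in> \<W>" "W' \<in> \<W>" "W \<subset> W'" for W W'
  proof -
    obtain v where v: "v \<in> W'" "v \<notin> W" using \<open>W \<subset> W'\<close> by auto
    have vB: "v \<notin> span (B W)" using v B(3)[OF that(1)] by simp
    then have "independent (insert v (B W))" using B(2)[OF that(1)] independent_insertI by blast
    moreover have "insert v (B W) \<subseteq> span (B W')"
      using v B(1)[OF that(1)] that(3) B(3)[OF that(2)] by auto
    ultimately have "card (insert v (B W)) \<le> card (B W')"
      using independent_span_bound[of "B W'"] bound[OF that(2)] by blast
    moreover have "v \<notin> B W" using vB span_base by blast
    ultimately show ?thesis using bound[OF that(1)] by simp
  qed
  have "inj_on (\<lambda>W. card (B W)) \<W>"
  proof (rule inj_onI)
    fix W W' assume W: "W \<in> \<W>" "W' \<in> \<W>" "card (B W) = card (B W')"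
    then show "W = W'" using chain[OF W(1,2)] less[OF W(1,2)] less[OF W(2,1)] by fastforce
  qed
  moreover have "(\<lambda>W. card (B W)) ` \<W> \<subseteq> {..card E}" using bound by auto
  then have "finite ((\<lambda>W. card (B W)) ` \<W>)" by (rule finite_subset) simp
  ultimately show ?thesis by (rule finite_imageD[rotated])
qed

section \<open>Polynomials and bidegrees\<close>

lemma sum_monomials: "(\<Sum>m\<in>keys f. single m (lookup f m)) = f"
proof (rule poly_mapping_eqI)
  fix k
  have "lookup (\<Sum>m\<in>keys f. single m (lookup f m)) k = (\<Sum>m\<in>keys f. if m = k then lookup f m else 0)"
    by (simp add: lookup_sum lookup_single when_def)
  also have "\<dots> = lookup f k" by (simp add: sum.delta in_keys_iff)
  finally show "lookup (\<Sum>m\<in>keys f. single m (lookup f m)) k = lookup f k" .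
qed

lemma poly_mapping_monomial_induct [case_names single add]:
  fixes f :: "'a \<Rightarrow>\<^sub>0 'b::comm_monoid_add"
  assumes 1: "\<And>m c. P (single m c)" and 2: "\<And>f g. P f \<Longrightarrow> P g \<Longrightarrow> P (f + g)"
  shows "P f"
proof -
  have "P (\<Sum>m\<in>A. single m (lookup f m))" if "finite A" for A
    using that
  proof induction
    case empty
    have "P (single undefined 0)" by (rule 1)
    then show ?case by (metis single_zero sum.empty)
  next
    case (insert m A)
    then show ?case using 1 2 by simp
  qed
  from this[of "keys f"] show ?thesis by (simp add: sum_monomials)
qed

lemma lookup_single_times:
  fixes g :: "('a::cancel_comm_monoid_add) \<Rightarrow>\<^sub>0 ('b::comm_semiring_1)"
  shows "lookup (single n c * g) (n + m) = c * lookup g m"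
proof (induction g rule: poly_mapping_monomial_induct)
  case (single k b)
  then show ?case by (simp add: mult_single lookup_single when_def)
next
  case (add f g)
  then show ?case by (simp add: distrib_left lookup_add)
qed

lemma keys_single_times:
  fixes g :: "('a::cancel_comm_monoid_add) \<Rightarrow>\<^sub>0 ('b::comm_semiring_1)"
  assumes "k \<in> keys (single n c * g)"
  shows "\<exists>m\<in>keys g. k = n + m"
  using keys_mult[of "single n c" g] assms by (auto split: if_splits)

lemma keys_timesE:
  fixes f g :: "('a::comm_monoid_add) \<Rightarrow>\<^sub>0 ('b::comm_semiring_1)"
  assumes "k \<in> keys (f * g)"
  obtains m n where "m \<in> keys f" "n \<in> keys g" "k = m + n"
  using keys_mult[of f g] assms by auto

definition mdeg :: "'v set \<Rightarrow> ('v::finite \<Rightarrow>\<^sub>0 nat) \<Rightarrow> nat" where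
  "mdeg U m = (\<Sum>i\<in>U. lookup m i)"

lemma mdeg_0 [simp]: "mdeg U 0 = 0"
  by (simp add: mdeg_def)

lemma mdeg_add [simp]: "mdeg U (m + n) = mdeg U m + mdeg U n"
  by (simp add: mdeg_def lookup_add sum.distrib)

lemma mdeg_single [simp]: "mdeg U (single i d) = (if i \<in> U then d else 0)"
  by (simp add: mdeg_def lookup_single when_def)

lemma lookup_le_mdeg: "i \<in> U \<Longrightarrow> lookup m i \<le> mdeg U m"
  unfolding mdeg_def by (rule member_le_sum) auto

lemma split_monomial:
  assumes "d \<le> mdeg U m"
  shows "\<exists>n m'. m = n + m' \<and> mdeg U n = d \<and> (\<forall>i. i \<notin> U \<longrightarrow> lookup n i = 0)"
  using assms
proof (induction d arbitrary: m)
  case 0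
  show ?case by (intro exI[of _ 0] exI[of _ m]) simp
next
  case (Suc d)
  then have "mdeg U m \<noteq> 0" by simp
  then obtain i where i: "i \<in> U" "lookup m i \<noteq> 0" unfolding mdeg_def by (meson sum.neutral)
  define m1 where "m1 = m - single i 1"
  have m: "m = single i 1 + m1"
    using i by (intro poly_mapping_eqI) (auto simp: m1_def lookup_add lookup_minus lookup_single when_def)
  then have "d \<le> mdeg U m1" using Suc.prems i by simp
  then obtain n m' where n: "m1 = n + m'" "mdeg U n = d" "\<forall>i. i \<notin> U \<longrightarrow> lookup n i = 0"
    using Suc.IH by blast
  then show ?case
    using m i by (intro exI[of _ "single i 1 + n"] exI[of _ m'])
      (auto simp: add.assoc lookup_add lookup_single when_def)
qed

text \<open>Polynomials are graded by giving the variables in \<open>U\<close> degree \<open>1\<close> and those in \<open>W\<close> degree \<open>-1\<close>.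
\<open>piece U W d\<close> is the part of degree \<open>d\<close>, and \<open>piece W U d\<close> that of degree \<open>-d\<close>; in this way
positive and negative degrees are treated symmetrically with \<open>d\<close> a natural number. If \<open>U\<close> and \<open>W\<close> are
disjoint and together contain all variables, then \<open>piece U W 0\<close> is the coordinate ring of the Segre embedding of the product of two
projective spaces.\<close>

definition piece :: "'v set \<Rightarrow> 'v set \<Rightarrow> nat \<Rightarrow> (('v::finite \<Rightarrow>\<^sub>0 nat) \<Rightarrow>\<^sub>0 'k::field) set" where
  "piece U W d = {f. \<forall>m\<in>keys f. mdeg U m = mdeg W m + d}"

lemma piece_degree: "f \<in> piece U W d \<Longrightarrow> m \<in> keys f \<Longrightarrow> mdeg U m = mdeg W m + d"
  by (simp add: piece_def)

lemma piece_0_commute: "piece U W 0 = piece W U 0"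
  by (auto simp: piece_def)

lemma piece_zero [simp]: "0 \<in> piece U W d"
  by (simp add: piece_def)

lemma piece_single: "mdeg U m = mdeg W m + d \<Longrightarrow> single m c \<in> piece U W d"
  by (simp add: piece_def)

lemma piece_one [simp]: "1 \<in> piece U W 0"
  by (simp add: piece_def)

lemma piece_add: "f \<in> piece U W d \<Longrightarrow> g \<in> piece U W d \<Longrightarrow> f + g \<in> piece U W d"
  using keys_add[of f g] by (fastforce simp: piece_def)

lemma piece_uminus: "f \<in> piece U W d \<Longrightarrow> - f \<in> piece U W d"
  by (simp add: piece_def in_keys_iff)

lemma piece_sum: "(\<And>i. i \<in> A \<Longrightarrow> f i \<in> piece U W d) \<Longrightarrow> sum f A \<in> piece U W d"
  by (induction A rule: infinite_finite_induct) (auto intro: piece_add)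

lemma piece_mult: "f \<in> piece U W d \<Longrightarrow> g \<in> piece U W e \<Longrightarrow> f * g \<in> piece U W (d + e)"
  by (auto simp: piece_def elim!: keys_timesE)

lemma piece_mult_opposite: "f \<in> piece U W d \<Longrightarrow> g \<in> piece W U d \<Longrightarrow> f * g \<in> piece U W 0"
  by (auto simp: piece_def elim!: keys_timesE)

lemma piece_mult_0: "f \<in> piece U W 0 \<Longrightarrow> g \<in> piece U W d \<Longrightarrow> f * g \<in> piece U W d"
  using piece_mult[of f U W 0 g d] by simp

lemma piece_power: "f \<in> piece U W d \<Longrightarrow> f ^ n \<in> piece U W (n * d)"
  by (induction n) (auto dest: piece_mult)

lemma unital_subring_piece_0: "unital_subring (piece U W 0)"
  unfolding unital_subring_def
  using piece_mult_0 piece_add[of _ U W 0 "- _"] piece_uminus by fastforce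

text \<open>On the part of degree \<open>0\<close> the degrees in \<open>U\<close> and in \<open>W\<close> agree, so either may serve as the gauge.\<close>

definition gauge_le :: "'v set \<Rightarrow> 'v set \<Rightarrow> nat \<Rightarrow> (('v::finite \<Rightarrow>\<^sub>0 nat) \<Rightarrow>\<^sub>0 'k::field) set" where
  "gauge_le U W n = {f \<in> piece U W 0. \<forall>m\<in>keys f. mdeg U m \<le> n}"

lemma gauge_le_commute: "gauge_le U W n = gauge_le W U n"
  by (auto simp: gauge_le_def piece_def)

section \<open>Homomorphisms between graded parts\<close>

text \<open>A homomorphism from the part of degree \<open>d\<close> to the part of degree \<open>0\<close> is multiplication by a
fraction, which can be read off from the values at \<open>x0\<^sup>d\<close> and at \<open>x1\<^sup>d\<close>. Since these two powers are
coprime, the fraction is a polynomial.\<close>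

lemma Hom_piece_is_multiplication:
  fixes \<Lambda> :: "(('v::{finite,linorder} \<Rightarrow>\<^sub>0 nat) \<Rightarrow>\<^sub>0 'k::field) \<Rightarrow> (('v \<Rightarrow>\<^sub>0 nat) \<Rightarrow>\<^sub>0 'k)"
  assumes UW: "U \<inter> W = {}" and x: "x0 \<in> U" "x1 \<in> U" "x0 \<noteq> x1" and y: "y \<in> W"
    and \<Lambda>: "\<And>h. h \<in> piece U W d \<Longrightarrow> \<Lambda> h \<in> piece U W 0"
    and linear: "\<And>s h. s \<in> piece U W 0 \<Longrightarrow> h \<in> piece U W d \<Longrightarrow> \<Lambda> (s * h) = s * \<Lambda> h"
  shows "\<exists>F\<in>piece W U d. \<forall>h\<in>piece U W d. \<Lambda> h = F * h"
proof -
  define n0 n1 where n: "n0 = single x0 d" "n1 = single x1 d"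
  define a0 a1 b :: "(('v \<Rightarrow>\<^sub>0 nat) \<Rightarrow>\<^sub>0 'k)" where a: "a0 = single n0 1" "a1 = single n1 1"
    and b: "b = single (single y d) 1"
  have a_piece: "a0 \<in> piece U W d" "a1 \<in> piece U W d" and b_piece: "b \<in> piece W U d"
    using x y UW by (auto simp: a b n intro!: piece_single)
  have nz: "a0 \<noteq> 0" "b \<noteq> 0" unfolding a b by (metis lookup_single_eq lookup_zero zero_neq_one)+
  have hb: "h * b \<in> piece U W 0" if "h \<in> piece U W d" for h
    by (rule piece_mult_opposite[OF that b_piece])
  \<comment> \<open>Multiplying by \<open>b = y\<^sup>d\<close> turns \<open>h\<close> and \<open>a0\<close> into scalars of degree \<open>0\<close>.\<close>
  have cross: "h * \<Lambda> a0 = a0 * \<Lambda> h" if h: "h \<in> piece U W d" for h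
  proof -
    have "(h * b) * \<Lambda> a0 = \<Lambda> ((h * b) * a0)" by (rule linear[symmetric, OF hb[OF h] a_piece(1)])
    also have "(h * b) * a0 = (a0 * b) * h" by (simp add: mult_ac)
    also have "\<Lambda> \<dots> = (a0 * b) * \<Lambda> h" by (rule linear[OF hb[OF a_piece(1)] h])
    finally have "b * (h * \<Lambda> a0) = b * (a0 * \<Lambda> h)" by (simp add: mult_ac)
    then show ?thesis using nz by simp
  qed
  define g where "g = \<Lambda> a0"
  \<comment> \<open>The case \<open>h = a1\<close> of \<open>cross\<close> shows that \<open>x0\<^sup>d\<close> divides \<open>x1\<^sup>d g\<close>, hence every monomial of \<open>g\<close>.\<close>
  have divisible: "\<exists>m'. m = n0 + m'" if m: "m \<in> keys g" for m
  proof -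
    have "lookup (a1 * g) (n1 + m) \<noteq> 0"
      using m by (simp add: a lookup_single_times in_keys_iff)
    then have "n1 + m \<in> keys (a0 * \<Lambda> a1)"
      using cross[OF a_piece(2)] by (simp add: g_def in_keys_iff)
    then obtain m' where "n1 + m = n0 + m'" using keys_single_times[of "n1 + m" n0 1 "\<Lambda> a1"] unfolding a by blast
    then have "lookup (n1 + m) x0 = lookup (n0 + m') x0" by simp
    then have "d \<le> lookup m x0" using x by (simp add: n lookup_add lookup_single when_def)
    then have "m = n0 + (m - n0)"
      by (intro poly_mapping_eqI) (auto simp: n lookup_add lookup_minus lookup_single when_def)
    then show ?thesis by blast
  qed
  define F where "F = (\<Sum>m\<in>keys g. single (m - n0) (lookup g m))"
  have "a0 * F = (\<Sum>m\<in>keys g. single (n0 + (m - n0)) (lookup g m))"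
    by (simp add: F_def a sum_distrib_left mult_single)
  also have "\<dots> = (\<Sum>m\<in>keys g. single m (lookup g m))"
    by (rule sum.cong) (use divisible in fastforce)+
  also have "\<dots> = g" by (rule sum_monomials)
  finally have F: "a0 * F = g" .
  have "F \<in> piece W U d"
    unfolding piece_def
  proof (intro CollectI ballI)
    fix m assume "m \<in> keys F"
    then have "n0 + m \<in> keys g" unfolding F[symmetric] a by (simp add: in_keys_iff lookup_single_times)
    then have "n0 + m \<in> keys (\<Lambda> a0)" by (simp add: g_def)
    then have "mdeg U (n0 + m) = mdeg W (n0 + m) + 0" by (rule piece_degree[OF \<Lambda>[OF a_piece(1)]])
    moreover have "x0 \<notin> W" using UW x by blast
    ultimately show "mdeg W m = mdeg U m + d" using x by (simp add: n)
  qed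
  moreover have "\<Lambda> h = F * h" if "h \<in> piece U W d" for h
  proof -
    have "a0 * \<Lambda> h = h * (a0 * F)" unfolding F g_def by (rule cross[OF that, symmetric])
    also have "\<dots> = a0 * (F * h)" by (simp add: mult_ac)
    finally show ?thesis using nz by simp
  qed
  ultimately show ?thesis by blast
qed

section \<open>Roots with respect to Frobenius\<close>

definition dilate :: "nat \<Rightarrow> ('v \<Rightarrow>\<^sub>0 nat) \<Rightarrow> ('v \<Rightarrow>\<^sub>0 nat)" where
  "dilate q m = Poly_Mapping.map ((*) q) m"

definition exp_div :: "nat \<Rightarrow> ('v \<Rightarrow>\<^sub>0 nat) \<Rightarrow> ('v \<Rightarrow>\<^sub>0 nat)" where
  "exp_div q m = Poly_Mapping.map (\<lambda>x. x div q) m"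

definition exp_mod :: "nat \<Rightarrow> ('v \<Rightarrow>\<^sub>0 nat) \<Rightarrow> ('v \<Rightarrow>\<^sub>0 nat)" where
  "exp_mod q m = Poly_Mapping.map (\<lambda>x. x mod q) m"

lemma lookup_dilate [simp]: "lookup (dilate q m) i = q * lookup m i"
  and lookup_exp_div [simp]: "lookup (exp_div q m) i = lookup m i div q"
  and lookup_exp_mod [simp]: "lookup (exp_mod q m) i = lookup m i mod q"
  by (simp_all add: dilate_def exp_div_def exp_mod_def map.rep_eq when_def)

lemma dilate_div_mod: "dilate q (exp_div q m) + exp_mod q m = m"
  by (rule poly_mapping_eqI) (simp add: lookup_add)

lemma dilate_unique:
  assumes "\<And>i. lookup r i < q"
  shows "dilate q m + r = k \<longleftrightarrow> exp_mod q k = r \<and> exp_div q k = m"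
proof
  assume k: "dilate q m + r = k"
  show "exp_mod q k = r \<and> exp_div q k = m"
    unfolding k[symmetric] using assms
    by (auto simp: lookup_add div_add1_eq[of "q * _"] intro!: poly_mapping_eqI)
next
  assume "exp_mod q k = r \<and> exp_div q k = m"
  then show "dilate q m + r = k" using dilate_div_mod by blast
qed

lemma mdeg_dilate [simp]: "mdeg U (dilate q m) = q * mdeg U m"
  by (simp add: mdeg_def sum_distrib_left)

lemma single_power: "single m c ^ n = single (dilate n m) ((c::'k::comm_semiring_1) ^ n)"
proof (induction n)
  case 0
  have "dilate 0 m = 0" by (rule poly_mapping_eqI) simp
  then show ?case by simp
next
  case (Suc n)
  have "dilate (Suc n) m = m + dilate n m" by (rule poly_mapping_eqI) (simp add: lookup_add)
  then show ?case using Suc by (simp add: mult_single)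
qed

lemma CHAR_poly_mapping:
  "CHAR(('m::{comm_monoid_add}) \<Rightarrow>\<^sub>0 ('k::comm_ring_1)) = CHAR('k)"
proof (rule CHAR_eqI)
  have *: "of_nat n = (0 :: 'm \<Rightarrow>\<^sub>0 'k) \<longleftrightarrow> of_nat n = (0 :: 'k)" for n
  proof
    assume "of_nat n = (0 :: 'm \<Rightarrow>\<^sub>0 'k)"
    then have "lookup (of_nat n :: 'm \<Rightarrow>\<^sub>0 'k) 0 = 0" by simp
    then show "of_nat n = (0 :: 'k)" by (simp add: lookup_of_nat)
  next
    assume "of_nat n = (0 :: 'k)"
    then have "single 0 (of_nat n :: 'k) = (0 :: 'm \<Rightarrow>\<^sub>0 'k)" by simp
    then show "of_nat n = (0 :: 'm \<Rightarrow>\<^sub>0 'k)" by simp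
  qed
  show "of_nat CHAR('k) = (0 :: 'm \<Rightarrow>\<^sub>0 'k)" using * by simp
  show "CHAR('k) dvd n" if "of_nat n = (0 :: 'm \<Rightarrow>\<^sub>0 'k)" for n
    using that * of_nat_eq_0_iff_char_dvd by blast
qed

text \<open>For \<open>q = p\<^sup>e\<close> these are the \<open>p\<^sup>-\<^sup>e\<close>-linear functionals of a field.\<close>

definition inverse_power_linear :: "nat \<Rightarrow> ('k::field \<Rightarrow> 'k) \<Rightarrow> bool" where
  "inverse_power_linear q \<kappa> \<longleftrightarrow> (\<forall>x y. \<kappa> (x + y) = \<kappa> x + \<kappa> y) \<and> (\<forall>c x. \<kappa> (c ^ q * x) = c * \<kappa> x)"

lemma inverse_power_linear_0: "inverse_power_linear q \<kappa> \<Longrightarrow> \<kappa> 0 = 0"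
  unfolding inverse_power_linear_def by (metis add_cancel_left_left add_0)

text \<open>The coordinate functionals of a basis of the field over its subfield of \<open>q\<close>-th powers. The index \<open>b\<close>
runs over all field elements; \<open>\<kappa> b\<close> is zero when \<open>b\<close> is not in the basis.\<close>

lemma field_power_basis:
  assumes p: "Factorial_Ring.prime CHAR('k::field)" and q: "q = CHAR('k) ^ e"
  shows "\<exists>\<kappa> :: 'k \<Rightarrow> 'k \<Rightarrow> 'k. (\<forall>b. inverse_power_linear q (\<kappa> b)) \<and>
    (\<forall>c. finite {b. \<kappa> b c \<noteq> 0} \<and> c = (\<Sum>b | \<kappa> b c \<noteq> 0. \<kappa> b c ^ q * b))"
proof -
  interpret V: vector_space "\<lambda>a x :: 'k. a ^ q * x"
    by unfold_locales
      (simp_all add: algebra_simps power_mult_distrib freshmans_dream'[OF p q])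
  define B where "B = V.extend_basis {}"
  have B: "V.independent B" "V.span B = UNIV"
    using V.extend_basis_superset V.independent_extend_basis V.span_extend_basis V.independent_empty
    unfolding B_def by blast+
  define \<kappa> where "\<kappa> b c = V.representation B c b" for b c
  have "inverse_power_linear q (\<kappa> b)" for b
    unfolding inverse_power_linear_def \<kappa>_def
    using B by (simp add: V.representation_add V.representation_scale)
  moreover have "finite {b. \<kappa> b c \<noteq> 0}" for c
    unfolding \<kappa>_def by (rule V.finite_representation)
  moreover have "c = (\<Sum>b | \<kappa> b c \<noteq> 0. \<kappa> b c ^ q * b)" for c
    unfolding \<kappa>_def using V.sum_nonzero_representation_eq[OF B(1), of c] B(2) by simp
  ultimately show ?thesis by blast
qed

text \<open>If the functionals \<open>\<kappa>\<close> are the coordinates of a basis \<open>B\<close> of the field over its \<open>q\<close>-th powers, the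
polynomials \<open>b x\<^sup>r\<close> with \<open>b \<in> B\<close> and all exponents of \<open>r\<close> below \<open>q\<close> form a basis over the
ring of \<open>q\<close>-th powers of polynomials, and \<open>frob_root\<close> is the \<open>q\<close>-th root of a coordinate of \<open>f\<close>.\<close>

definition frob_root :: "nat \<Rightarrow> ('v \<Rightarrow>\<^sub>0 nat) \<Rightarrow> ('k \<Rightarrow> 'k) \<Rightarrow> (('v::finite \<Rightarrow>\<^sub>0 nat) \<Rightarrow>\<^sub>0 'k::field) \<Rightarrow> (('v \<Rightarrow>\<^sub>0 nat) \<Rightarrow>\<^sub>0 'k)" where
  "frob_root q r \<kappa> f = Abs_poly_mapping (\<lambda>m. \<kappa> (lookup f (dilate q m + r)))"

lemma lookup_frob_root:
  assumes "0 < q" and \<kappa>: "inverse_power_linear q \<kappa>"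
  shows "lookup (frob_root q r \<kappa> f) m = \<kappa> (lookup f (dilate q m + r))"
proof -
  note \<kappa>0 = inverse_power_linear_0[OF \<kappa>]
  have "inj (\<lambda>m. dilate q m + r)"
    using assms(1) by (auto intro!: injI simp: poly_mapping_eq_iff fun_eq_iff lookup_add)
  then have "finite ((\<lambda>m. dilate q m + r) -` keys f)" by (intro finite_vimageI) auto
  moreover have "{m. \<kappa> (lookup f (dilate q m + r)) \<noteq> 0} \<subseteq> (\<lambda>m. dilate q m + r) -` keys f"
    using \<kappa>0 by (auto simp: in_keys_iff)
  ultimately have "finite {m. \<kappa> (lookup f (dilate q m + r)) \<noteq> 0}" by (rule finite_subset[rotated])
  then show ?thesis by (simp add: frob_root_def)
qed

lemma frob_root_add:
  assumes "0 < q" "inverse_power_linear q \<kappa>"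
  shows "frob_root q r \<kappa> (f + g) = frob_root q r \<kappa> f + frob_root q r \<kappa> g"
  using assms
  by (intro poly_mapping_eqI) (simp add: lookup_frob_root lookup_add inverse_power_linear_def)

lemma frob_root_single:
  assumes q: "0 < q" and \<kappa>: "inverse_power_linear q \<kappa>" and r: "\<And>i. lookup r i < q"
  shows "frob_root q r \<kappa> (single k c) = (if exp_mod q k = r then single (exp_div q k) (\<kappa> c) else 0)"
proof (rule poly_mapping_eqI)
  fix m
  have "k = dilate q m + r \<longleftrightarrow> exp_mod q k = r \<and> exp_div q k = m"
    using dilate_unique[OF r, of m k] by auto
  then show "lookup (frob_root q r \<kappa> (single k c)) m =
      lookup (if exp_mod q k = r then single (exp_div q k) (\<kappa> c) else 0) m"
    using inverse_power_linear_0[OF \<kappa>] by (auto simp: lookup_frob_root[OF q \<kappa>] lookup_single when_def)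
qed

lemma exp_div_mod_dilate_add:
  assumes "0 < q"
  shows "exp_div q (dilate q m + k) = m + exp_div q k" "exp_mod q (dilate q m + k) = exp_mod q k"
  using assms by (auto intro!: poly_mapping_eqI simp: lookup_add)

lemma frobenius_add:
  fixes f g :: "('v \<Rightarrow>\<^sub>0 nat) \<Rightarrow>\<^sub>0 'k::field"
  assumes p: "Factorial_Ring.prime CHAR('k)" and q: "q = CHAR('k) ^ e"
  shows "(f + g) ^ q = f ^ q + g ^ q"
  using freshmans_dream'[of q e f g] p q by (simp add: CHAR_poly_mapping)

lemma frob_root_linear:
  fixes f s :: "('v::finite \<Rightarrow>\<^sub>0 nat) \<Rightarrow>\<^sub>0 'k::field"
  assumes p: "Factorial_Ring.prime CHAR('k)" and q: "q = CHAR('k) ^ e"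
    and \<kappa>: "inverse_power_linear q \<kappa>" and r: "\<And>i. lookup r i < q"
  shows "frob_root q r \<kappa> (s ^ q * f) = s * frob_root q r \<kappa> f"
proof -
  have q0: "0 < q" using p q prime_gt_0_nat by simp
  note add = frob_root_add[OF q0 \<kappa>]
  show ?thesis
  proof (induction s arbitrary: f rule: poly_mapping_monomial_induct)
    case (single m c)
    show ?case
    proof (induction f rule: poly_mapping_monomial_induct)
      case (single k b)
      have "\<kappa> (c ^ q * b) = c * \<kappa> b" using \<kappa> by (simp add: inverse_power_linear_def)
      then show ?case
        by (simp add: single_power mult_single frob_root_single[OF q0 \<kappa> r] exp_div_mod_dilate_add[OF q0])
    next
      case (add f g)
      then show ?case by (simp add: distrib_left frob_root_add[OF q0 \<kappa>])
    qed
  next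
    case (add s t)
    then show ?case by (simp add: frobenius_add[OF p q] distrib_right frob_root_add[OF q0 \<kappa>])
  qed
qed

lemma keys_frob_root:
  assumes "0 < q" "inverse_power_linear q \<kappa>" "m \<in> keys (frob_root q r \<kappa> f)"
  shows "dilate q m + r \<in> keys f"
  using assms inverse_power_linear_0[OF assms(2)] by (auto simp: in_keys_iff lookup_frob_root)

lemma single_sum: "single k (sum g A) = (\<Sum>i\<in>A. single k (g i))"
  by (induction A rule: infinite_finite_induct) (auto simp: single_add)

lemma frobenius_expansion:
  fixes f :: "('v::finite \<Rightarrow>\<^sub>0 nat) \<Rightarrow>\<^sub>0 'k::field"
  assumes p: "Factorial_Ring.prime CHAR('k)" and q: "q = CHAR('k) ^ e"
    and \<kappa>: "\<And>b. inverse_power_linear q (\<kappa> b)"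
    and fin: "\<And>c. finite {b. \<kappa> b c \<noteq> 0}" and basis: "\<And>c. c = (\<Sum>b | \<kappa> b c \<noteq> 0. \<kappa> b c ^ q * b)"
  defines "B \<equiv> \<Union>m\<in>keys f. {b. \<kappa> b (lookup f m) \<noteq> 0}"
  shows "f = (\<Sum>r\<in>exp_mod q ` keys f. \<Sum>b\<in>B. frob_root q r (\<kappa> b) f ^ q * single r b)"
proof -
  have q0: "0 < q" using p q prime_gt_0_nat by simp
  have \<kappa>0: "\<kappa> b 0 = 0" for b by (rule inverse_power_linear_0[OF \<kappa>])
  have finB: "finite B" using fin by (auto simp: B_def)
  let ?R = "exp_mod q ` keys f"
  define T where "T g = (\<Sum>r\<in>?R. \<Sum>b\<in>B. frob_root q r (\<kappa> b) g ^ q * single r b)" for g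
  have T_add: "T (g + h) = T g + T h" for g h
    by (simp add: T_def frob_root_add[OF q0 \<kappa>] frobenius_add[OF p q] distrib_right sum.distrib)
  have T_0: "T 0 = 0" using T_add[of 0 0] by simp
  have T_sum: "T (\<Sum>m\<in>A. g m) = (\<Sum>m\<in>A. T (g m))" for A and g :: "_ \<Rightarrow> ('v \<Rightarrow>\<^sub>0 nat) \<Rightarrow>\<^sub>0 'k"
    by (induction A rule: infinite_finite_induct) (simp_all add: T_0 T_add)
  \<comment> \<open>By additivity it suffices to treat the monomials of \<open>f\<close>, where only the remainder of \<open>k\<close>
    contributes and the identity is the basis expansion of the coefficient.\<close>
  have T_single: "T (single k (lookup f k)) = single k (lookup f k)" if k: "k \<in> keys f" for k
  proof -
    let ?c = "lookup f k"
    have lt: "lookup r i < q" if "r \<in> ?R" for r i using that q0 by auto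
    have "T (single k ?c) = (\<Sum>r\<in>?R. if exp_mod q k = r then
        \<Sum>b\<in>B. single (exp_div q k) (\<kappa> b ?c) ^ q * single (exp_mod q k) b else 0)"
      unfolding T_def
    proof (rule sum.cong[OF refl])
      fix r assume r: "r \<in> ?R"
      show "(\<Sum>b\<in>B. frob_root q r (\<kappa> b) (single k ?c) ^ q * single r b) = (if exp_mod q k = r then
        \<Sum>b\<in>B. single (exp_div q k) (\<kappa> b ?c) ^ q * single (exp_mod q k) b else 0)"
        using q0 by (auto simp: zero_power frob_root_single[OF q0 \<kappa> lt[OF r]] inverse_power_linear_0[OF \<kappa>])
    qed
    also have "\<dots> = (\<Sum>b\<in>B. single (exp_div q k) (\<kappa> b ?c) ^ q * single (exp_mod q k) b)"
      using k by (simp add: sum.delta)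
    also have "\<dots> = single k (\<Sum>b\<in>B. \<kappa> b ?c ^ q * b)"
      by (simp add: single_sum single_power mult_single dilate_div_mod)
    also have "(\<Sum>b\<in>B. \<kappa> b ?c ^ q * b) = (\<Sum>b | \<kappa> b ?c \<noteq> 0. \<kappa> b ?c ^ q * b)"
      by (rule sum.mono_neutral_right[OF finB]) (use k q0 in \<open>auto simp: B_def\<close>)
    also have "\<dots> = ?c" by (rule basis[symmetric])
    finally show ?thesis .
  qed
  have "T f = T (\<Sum>m\<in>keys f. single m (lookup f m))" by (simp add: sum_monomials)
  also have "\<dots> = f" unfolding T_sum using T_single by (simp add: sum_monomials cong: sum.cong)
  finally show ?thesis by (simp add: T_def)
qed

section \<open>Cartier maps of the Segre ring\<close>

text \<open>The \<open>q\<close>-inverse linear endomorphisms of the ring of degree \<open>0\<close>, that is, the elements of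
\<open>Hom(F\<^sup>e\<^sub>* S, S)\<close> for \<open>q = p\<^sup>e\<close>.\<close>

definition cartier_map :: "'v set \<Rightarrow> 'v set \<Rightarrow> nat \<Rightarrow>
    ((('v::finite \<Rightarrow>\<^sub>0 nat) \<Rightarrow>\<^sub>0 'k::field) \<Rightarrow> (('v \<Rightarrow>\<^sub>0 nat) \<Rightarrow>\<^sub>0 'k)) \<Rightarrow> bool" where
  "cartier_map U W q \<phi> \<longleftrightarrow> (\<forall>f\<in>piece U W 0. \<phi> f \<in> piece U W 0) \<and>
     (\<forall>f\<in>piece U W 0. \<forall>g\<in>piece U W 0. \<phi> (f + g) = \<phi> f + \<phi> g) \<and>
     (\<forall>s\<in>piece U W 0. \<forall>f\<in>piece U W 0. \<phi> (s ^ q * f) = s * \<phi> f)"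

lemma cartier_map_commute: "cartier_map U W q \<phi> \<longleftrightarrow> cartier_map W U q \<phi>"
  unfolding cartier_map_def piece_0_commute[of U W] ..

lemma cartier_map_sum:
  assumes "cartier_map U W q \<phi>" "\<And>i. i \<in> A \<Longrightarrow> f i \<in> piece U W 0"
  shows "\<phi> (sum f A) = (\<Sum>i\<in>A. \<phi> (f i))"
proof -
  have add: "\<phi> (f + g) = \<phi> f + \<phi> g" if "f \<in> piece U W 0" "g \<in> piece U W 0" for f g
    using assms(1) that by (simp add: cartier_map_def)
  have 0: "\<phi> 0 = 0" using add[of 0 0] by simp
  show ?thesis using assms(2)
    by (induction A rule: infinite_finite_induct) (simp_all add: 0 add piece_sum)
qed

lemma frob_root_piece:
  assumes q: "0 < q" and \<kappa>: "inverse_power_linear q \<kappa>"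
    and r: "mdeg W r = mdeg U r + q * d" and f: "f \<in> piece U W 0"
  shows "frob_root q r \<kappa> f \<in> piece U W d"
  unfolding piece_def
proof (intro CollectI ballI)
  fix m assume "m \<in> keys (frob_root q r \<kappa> f)"
  then have "dilate q m + r \<in> keys f" by (rule keys_frob_root[OF q \<kappa>])
  then have "mdeg U (dilate q m + r) = mdeg W (dilate q m + r)" using piece_degree[OF f] by fastforce
  then have "q * mdeg U m = q * (mdeg W m + d)" using r by (simp add: algebra_simps)
  then show "mdeg U m = mdeg W m + d" using q by simp
qed

text \<open>Taking the coordinate at \<open>r\<close> changes the degree by a constant \<open>d\<close> that depends on \<open>r\<close>, and a monomial
of degree \<open>-d\<close> in the variables of \<open>W\<close> alone restores degree \<open>0\<close>. This monomial does not affect the degree in \<open>U\<close>,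
so the gauge is divided by \<open>q\<close> without an error term.\<close>

lemma cartier_map_frob_root:
  fixes \<kappa> :: "'k::field \<Rightarrow> 'k" and n r :: "'v::finite \<Rightarrow>\<^sub>0 nat"
  assumes p: "Factorial_Ring.prime CHAR('k)" and q: "q = CHAR('k) ^ e"
    and \<kappa>: "inverse_power_linear q \<kappa>" and r: "\<And>i. lookup r i < q"
    and rd: "mdeg W r = mdeg U r + q * d" and n: "mdeg W n = d" "mdeg U n = 0"
  shows "cartier_map U W q (\<lambda>f. single n 1 * frob_root q r \<kappa> f)"
    and "f \<in> gauge_le U W G \<Longrightarrow> single n 1 * frob_root q r \<kappa> f \<in> gauge_le U W (G div q)"
proof -
  have q0: "0 < q" using p q prime_gt_0_nat by simp
  have npiece: "single n 1 \<in> piece W U d" using n by (intro piece_single) simp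
  have closed: "single n 1 * frob_root q r \<kappa> f \<in> piece U W 0" if "f \<in> piece U W 0" for f
    using piece_mult_opposite[OF frob_root_piece[OF q0 \<kappa> rd that] npiece] by (simp add: mult.commute)
  show "cartier_map U W q (\<lambda>f. single n 1 * frob_root q r \<kappa> f)"
    unfolding cartier_map_def
    using closed by (auto simp: frob_root_add[OF q0 \<kappa>] frob_root_linear[OF p q \<kappa> r] distrib_left)
  assume f: "f \<in> gauge_le U W G"
  have "mdeg U k \<le> G div q" if k: "k \<in> keys (single n 1 * frob_root q r \<kappa> f)" for k
  proof -
    obtain m where m: "m \<in> keys (frob_root q r \<kappa> f)" "k = n + m" using keys_single_times[OF k] by auto
    have "mdeg U (dilate q m + r) \<le> G" using keys_frob_root[OF q0 \<kappa> m(1)] f unfolding gauge_le_def by blast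
    then have "q * mdeg U m \<le> G" by simp
    then show ?thesis using m n q0 by (simp add: less_eq_div_iff_mult_less_eq mult.commute)
  qed
  then show "single n 1 * frob_root q r \<kappa> f \<in> gauge_le U W (G div q)"
    using closed f by (simp add: gauge_le_def)
qed

locale bipartition =
  fixes U W :: "'v::{finite,linorder} set"
  assumes disjoint: "U \<inter> W = {}"
    and two_U: "\<exists>x\<in>U. \<exists>x'\<in>U. x \<noteq> x'" and two_W: "\<exists>y\<in>W. \<exists>y'\<in>W. y \<noteq> y'"
begin

lemma swapped: "bipartition W U"
  using disjoint two_U two_W by unfold_locales auto

text \<open>On the summand of \<open>F\<^sup>e\<^sub>* S\<close> at \<open>b x\<^sup>r\<close>, which is isomorphic to the part of degree \<open>d\<close>, the map \<open>\<phi>\<close>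
is multiplication by a polynomial \<open>F\<close> of degree \<open>-d\<close>. Each monomial of \<open>F\<close> is a monomial of degree \<open>0\<close>
times a monomial of degree \<open>-d\<close> in the variables of \<open>W\<close> alone, so \<open>\<phi>\<close> is a combination of the maps in
\<open>cartier_map_frob_root\<close>.\<close>

lemma cartier_map_component:
  fixes \<kappa> :: "'k::field \<Rightarrow> 'k" and f :: "('v \<Rightarrow>\<^sub>0 nat) \<Rightarrow>\<^sub>0 'k"
  assumes p: "Factorial_Ring.prime CHAR('k)" and q: "q = CHAR('k) ^ e"
    and \<kappa>: "inverse_power_linear q \<kappa>" and r: "\<And>i. lookup r i < q"
    and rd: "mdeg W r = mdeg U r + q * d"
    and \<phi>: "cartier_map U W q \<phi>" and f: "f \<in> gauge_le U W G"
    and J: "ideal_of (piece U W 0) J"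
    and sub: "\<And>\<psi>. cartier_map U W q \<psi> \<Longrightarrow> \<psi> f \<in> gauge_le U W (G div q) \<Longrightarrow> \<psi> f \<in> J"
  shows "frob_root q r \<kappa> f ^ q * single r b \<in> piece U W 0"
    and "\<phi> (frob_root q r \<kappa> f ^ q * single r b) \<in> J"
proof -
  have q0: "0 < q" using p q prime_gt_0_nat by simp
  define \<Lambda> where "\<Lambda> h = \<phi> (h ^ q * single r b)" for h
  define h where "h = frob_root q r \<kappa> f"
  have h: "h \<in> piece U W d"
    unfolding h_def using f by (intro frob_root_piece[OF q0 \<kappa> rd]) (simp add: gauge_le_def)
  have r_piece: "single r b \<in> piece W U (q * d)" using rd by (intro piece_single) simp
  have closed: "g ^ q * single r b \<in> piece U W 0" if "g \<in> piece U W d" for g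
    using piece_mult_opposite[OF piece_power[OF that] r_piece] .
  show "frob_root q r \<kappa> f ^ q * single r b \<in> piece U W 0" using closed[OF h] by (simp add: h_def)
  obtain x x' y where xy: "x \<in> U" "x' \<in> U" "x \<noteq> x'" "y \<in> W" using two_U two_W by blast
  have "\<exists>F\<in>piece W U d. \<forall>h\<in>piece U W d. \<Lambda> h = F * h"
  proof (rule Hom_piece_is_multiplication[OF disjoint xy])
    show "\<Lambda> g \<in> piece U W 0" if "g \<in> piece U W d" for g
      using \<phi> closed[OF that] by (simp add: \<Lambda>_def cartier_map_def)
    show "\<Lambda> (s * g) = s * \<Lambda> g" if "s \<in> piece U W 0" "g \<in> piece U W d" for s g
      using \<phi> closed[OF that(2)] that(1)
      by (simp add: \<Lambda>_def cartier_map_def power_mult_distrib mult.assoc)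
  qed
  then obtain F where F: "F \<in> piece W U d" "\<Lambda> h = F * h" using h by blast
  have term_in_J: "single m c * h \<in> J" if m: "m \<in> keys F" for m c
  proof -
    have deg: "mdeg W m = mdeg U m + d" using F(1) m by (simp add: piece_def)
    then obtain n m' where n: "m = n + m'" "mdeg W n = d" "\<forall>i. i \<notin> W \<longrightarrow> lookup n i = 0"
      using split_monomial[of d W m] by auto
    have nU: "mdeg U n = 0" unfolding mdeg_def using n(3) disjoint by (intro sum.neutral) blast
    have "single n 1 * h \<in> J"
      unfolding h_def
      using sub[OF cartier_map_frob_root(1)[OF p q \<kappa> r rd n(2) nU]
          cartier_map_frob_root(2)[OF p q \<kappa> r rd n(2) nU f]] .
    moreover have "single m' c \<in> piece U W 0" using deg n(1,2) nU by (intro piece_single) simp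
    ultimately have "single m' c * (single n 1 * h) \<in> J" by (rule ideal_ofD(4)[OF J, rotated])
    moreover have "single m c = single m' c * single n 1" by (simp add: n(1) mult_single add.commute)
    ultimately show ?thesis by (simp add: mult.assoc)
  qed
  have "F * h = (\<Sum>m\<in>keys F. single m (lookup F m) * h)"
    by (simp add: sum_monomials flip: sum_distrib_right)
  moreover have "(\<Sum>m\<in>A. single m (lookup F m) * h) \<in> J" if "A \<subseteq> keys F" for A
    using finite_subset[OF that finite_keys] that
    by (induction A rule: finite_induct) (auto intro: ideal_ofD[OF J] term_in_J)
  ultimately show "\<phi> (frob_root q r \<kappa> f ^ q * single r b) \<in> J"
    using F(2) by (simp add: \<Lambda>_def h_def)
qed

text \<open>For remainders \<open>r\<close> of exponents of balanced monomials, the difference of the degrees of \<open>r\<close> in \<open>U\<close> and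
in \<open>W\<close> is a multiple of \<open>q\<close>; its sign decides on which side the correcting monomial is needed.\<close>

lemma residue_degree_cases:
  assumes q: "0 < q" and f: "f \<in> piece U W 0" and r: "r \<in> exp_mod q ` keys f"
  obtains d where "mdeg W r = mdeg U r + q * d" | d where "mdeg U r = mdeg W r + q * d"
proof -
  obtain k where k: "k \<in> keys f" "r = exp_mod q k" using r by auto
  have "mdeg U (dilate q (exp_div q k) + r) = mdeg W (dilate q (exp_div q k) + r)"
    using f k by (simp add: dilate_div_mod piece_def)
  then have eq: "q * mdeg U (exp_div q k) + mdeg U r = q * mdeg W (exp_div q k) + mdeg W r" by simp
  show thesis
  proof (cases "mdeg W (exp_div q k) \<le> mdeg U (exp_div q k)")
    case True
    then obtain d where "mdeg U (exp_div q k) = mdeg W (exp_div q k) + d" using le_Suc_ex by blast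
    then show thesis using eq that(1)[of d] by (simp add: algebra_simps)
  next
    case False
    then obtain d where "mdeg W (exp_div q k) = mdeg U (exp_div q k) + d" using le_Suc_ex nat_le_linear by blast
    then show thesis using eq that(2)[of d] by (simp add: algebra_simps)
  qed
qed

text \<open>Expand \<open>f\<close> in the basis \<open>b x\<^sup>r\<close> and apply \<open>cartier_map_component\<close> to each term, with \<open>U\<close> and \<open>W\<close>
exchanged where the degree of the coordinate is negative.\<close>

theorem cartier_map_gauge_bound:
  fixes f :: "('v \<Rightarrow>\<^sub>0 nat) \<Rightarrow>\<^sub>0 'k::field"
  assumes p: "Factorial_Ring.prime CHAR('k)" and q: "q = CHAR('k) ^ e"
    and \<phi>: "cartier_map U W q \<phi>" and f: "f \<in> gauge_le U W G"
    and J: "ideal_of (piece U W 0) J"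
    and sub: "\<And>\<psi>. cartier_map U W q \<psi> \<Longrightarrow> \<psi> f \<in> gauge_le U W (G div q) \<Longrightarrow> \<psi> f \<in> J"
  shows "\<phi> f \<in> J"
proof -
  have q0: "0 < q" using p q prime_gt_0_nat by simp
  obtain \<kappa> :: "'k \<Rightarrow> 'k \<Rightarrow> 'k" where \<kappa>: "\<And>b. inverse_power_linear q (\<kappa> b)"
    and fin: "\<And>c. finite {b. \<kappa> b c \<noteq> 0}" and basis: "\<And>c. c = (\<Sum>b | \<kappa> b c \<noteq> 0. \<kappa> b c ^ q * b)"
    using field_power_basis[OF p q] by blast
  define B where "B = (\<Union>m\<in>keys f. {b. \<kappa> b (lookup f m) \<noteq> 0})"
  let ?R = "exp_mod q ` keys f"
  let ?t = "\<lambda>r b. frob_root q r (\<kappa> b) f ^ q * single r b"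
  have f0: "f \<in> piece U W 0" using f by (simp add: gauge_le_def)
  have expansion: "f = (\<Sum>r\<in>?R. \<Sum>b\<in>B. ?t r b)"
    unfolding B_def by (rule frobenius_expansion[OF p q \<kappa> fin basis])
  have comp: "?t r b \<in> piece U W 0 \<and> \<phi> (?t r b) \<in> J" if r: "r \<in> ?R" for r b
  proof -
    have lt: "\<And>i. lookup r i < q" using r q0 by auto
    show ?thesis
    proof (rule residue_degree_cases[OF q0 f0 r])
      fix d assume "mdeg W r = mdeg U r + q * d"
      from cartier_map_component[OF p q \<kappa> lt this \<phi> f J] sub show ?thesis by blast
    next
      fix d assume d: "mdeg U r = mdeg W r + q * d"
      have \<phi>': "cartier_map W U q \<phi>" using \<phi> cartier_map_commute by blast
      have f': "f \<in> gauge_le W U G" using f gauge_le_commute by blast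
      have J': "ideal_of (piece W U 0) J" using J by (simp add: piece_0_commute)
      have sub': "\<psi> f \<in> J" if "cartier_map W U q \<psi>" "\<psi> f \<in> gauge_le W U (G div q)" for \<psi>
        using sub that cartier_map_commute gauge_le_commute by blast
      show ?thesis using bipartition.cartier_map_component[OF swapped p q \<kappa> lt d \<phi>' f' J'] sub'
        piece_0_commute[of U W] by blast
    qed
  qed
  have sumJ: "(\<Sum>i\<in>A. g i) \<in> J" if "\<And>i. i \<in> A \<Longrightarrow> g i \<in> J" for A and g :: "_ \<Rightarrow> ('v \<Rightarrow>\<^sub>0 nat) \<Rightarrow>\<^sub>0 'k"
    using that by (induction A rule: infinite_finite_induct) (auto intro: ideal_ofD[OF J])
  have "\<phi> f = \<phi> (\<Sum>r\<in>?R. \<Sum>b\<in>B. ?t r b)" by (rule arg_cong[OF expansion])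
  also have "\<dots> = (\<Sum>r\<in>?R. \<phi> (\<Sum>b\<in>B. ?t r b))"
    by (rule cartier_map_sum[OF \<phi>], rule piece_sum) (use comp in blast)
  also have "\<dots> = (\<Sum>r\<in>?R. \<Sum>b\<in>B. \<phi> (?t r b))"
    by (intro sum.cong refl cartier_map_sum[OF \<phi>]) (use comp in blast)
  also have "\<dots> = (\<Sum>(r, b)\<in>?R \<times> B. \<phi> (?t r b))" by (rule sum.cartesian_product)
  also have "\<dots> \<in> J" by (rule sumJ) (use comp in auto)
  finally show ?thesis .
qed

text \<open>Some coordinate of a nonzero \<open>f\<close> is nonzero, and multiplication by a monomial keeps it so.\<close>

theorem cartier_map_gauge_nonzero:
  fixes f :: "('v \<Rightarrow>\<^sub>0 nat) \<Rightarrow>\<^sub>0 'k::field"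
  assumes p: "Factorial_Ring.prime CHAR('k)" and q: "q = CHAR('k) ^ e"
    and f: "f \<in> gauge_le U W G" and nz: "f \<noteq> 0"
  shows "\<exists>\<psi>. cartier_map U W q \<psi> \<and> \<psi> f \<in> gauge_le U W (G div q) \<and> \<psi> f \<noteq> 0"
proof -
  have q0: "0 < q" using p q prime_gt_0_nat by simp
  obtain \<kappa> :: "'k \<Rightarrow> 'k \<Rightarrow> 'k" where \<kappa>: "\<And>b. inverse_power_linear q (\<kappa> b)"
    and basis: "\<And>c. c = (\<Sum>b | \<kappa> b c \<noteq> 0. \<kappa> b c ^ q * b)"
    using field_power_basis[OF p q] by blast
  obtain k where k: "k \<in> keys f" using nz by (metis keys_eq_empty ex_in_conv)
  have "\<exists>b. \<kappa> b (lookup f k) \<noteq> 0"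
  proof (rule ccontr)
    assume "\<nexists>b. \<kappa> b (lookup f k) \<noteq> 0"
    then have "lookup f k = 0" using basis[of "lookup f k"] by simp
    then show False using k by (simp add: in_keys_iff)
  qed
  then obtain b where b: "\<kappa> b (lookup f k) \<noteq> 0" by blast
  let ?r = "exp_mod q k"
  have "lookup (frob_root q ?r (\<kappa> b) f) (exp_div q k) \<noteq> 0"
    using b by (simp add: lookup_frob_root[OF q0 \<kappa>] dilate_div_mod)
  then have root: "frob_root q ?r (\<kappa> b) f \<noteq> 0" by auto
  have one: "single n (1::'k) \<noteq> 0" for n :: "'v \<Rightarrow>\<^sub>0 nat" by (metis lookup_single_eq lookup_zero zero_neq_one)
  have lt: "\<And>i. lookup ?r i < q" using q0 by simp
  have f0: "f \<in> piece U W 0" using f by (simp add: gauge_le_def)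
  obtain x y where xy: "x \<in> U" "y \<in> W" using two_U two_W by blast
  then have xy': "x \<notin> W" "y \<notin> U" using disjoint by auto
  show ?thesis
  proof (rule residue_degree_cases[OF q0 f0, of ?r])
    show "?r \<in> exp_mod q ` keys f" using k by simp
  next
    fix d assume d: "mdeg W ?r = mdeg U ?r + q * d"
    have n: "mdeg W (single y d) = d" "mdeg U (single y d) = 0" using xy xy' by auto
    show ?thesis
      using cartier_map_frob_root[OF p q \<kappa> lt d n] f root one
      by (intro exI[of _ "\<lambda>f. single (single y d) 1 * frob_root q ?r (\<kappa> b) f"]) simp
  next
    fix d assume d: "mdeg U ?r = mdeg W ?r + q * d"
    have n: "mdeg U (single x d) = d" "mdeg W (single x d) = 0" using xy xy' by auto
    show ?thesis
      using cartier_map_frob_root[OF p q \<kappa> lt d n] f root one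
      by (intro exI[of _ "\<lambda>f. single (single x d) 1 * frob_root q ?r (\<kappa> b) f"])
        (simp add: cartier_map_commute[of U] gauge_le_commute[of U])
  qed
qed

end

section \<open>The Segre ring is gauge bounded\<close>

locale covering_bipartition = bipartition U W for U W :: "'v::{finite,linorder} set" +
  assumes cover: "U \<union> W = UNIV"
begin

lemma balanced_monomial_induct [consumes 1, case_names zero add]:
  assumes "mdeg U m = mdeg W m"
    and 0: "P 0" and add: "\<And>i j m. i \<in> U \<Longrightarrow> j \<in> W \<Longrightarrow> P m \<Longrightarrow> P (single i 1 + single j 1 + m)"
  shows "P m"
  using assms(1)
proof (induction "mdeg U m" arbitrary: m)
  case 0
  then have "lookup m i = 0" for i
    using cover lookup_le_mdeg[of i U m] lookup_le_mdeg[of i W m] by (metis UNIV_I UnE le_zero_eq)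
  then have "m = 0" by (intro poly_mapping_eqI) simp
  then show ?case using assms(2) by simp
next
  case (Suc d)
  have split: "\<exists>i m'. i \<in> A \<and> m = single i 1 + m'" if nz: "mdeg A m \<noteq> 0" for A and m :: "'v \<Rightarrow>\<^sub>0 nat"
  proof -
    obtain i where i: "i \<in> A" "lookup m i \<noteq> 0" using nz unfolding mdeg_def by (meson sum.neutral)
    have "m = single i 1 + (m - single i 1)"
      using i by (intro poly_mapping_eqI) (auto simp: lookup_add lookup_minus lookup_single when_def)
    then show ?thesis using i by blast
  qed
  obtain i m1 where i: "i \<in> U" "m = single i 1 + m1" using split[of U m] Suc by auto
  have iW: "i \<notin> W" using i disjoint by blast
  then have "mdeg W m1 \<noteq> 0" using Suc i by simp
  then obtain j m2 where j: "j \<in> W" "m1 = single j 1 + m2" using split by blast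
  have jU: "j \<notin> U" using j disjoint by blast
  have "P m2" using Suc i j iW jU by (intro Suc.hyps(1)) simp_all
  then show ?case using add[OF i(1) j(1)] i j by (simp add: add.assoc)
qed

text \<open>The ring is generated over the field by the products of a variable in \<open>U\<close> and a variable in \<open>W\<close>.\<close>

lemma noetherian_piece_0: "noetherian_subring (piece U W 0 :: (('v \<Rightarrow>\<^sub>0 nat) \<Rightarrow>\<^sub>0 'k::field) set)"
proof (rule noetherian_subring_finitely_generated)
  let ?K = "range (single 0) :: (('v \<Rightarrow>\<^sub>0 nat) \<Rightarrow>\<^sub>0 'k) set"
  let ?Y = "(\<lambda>(i, j). single (single i 1 + single j 1) 1) ` (U \<times> W) :: (('v \<Rightarrow>\<^sub>0 nat) \<Rightarrow>\<^sub>0 'k) set"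
  show "noetherian_subring ?K"
  proof (rule noetherian_subring_field)
    show "unital_subring ?K" unfolding unital_subring_def
      by (auto simp: mult_single simp flip: single_diff single_one)
    fix x assume "x \<in> ?K" "x \<noteq> 0"
    then obtain c where c: "x = single 0 c" "c \<noteq> 0" by (metis imageE single_zero)
    then have "single 0 (inverse c) * x = 1" by (simp add: mult_single)
    then show "\<exists>y\<in>?K. y * x = 1" by blast
  qed
  show "finite ?Y" by simp
  show "unital_subring (piece U W 0 :: (('v \<Rightarrow>\<^sub>0 nat) \<Rightarrow>\<^sub>0 'k) set)" by (rule unital_subring_piece_0)
  show "?K \<subseteq> piece U W 0" by (auto intro: piece_single)
  show "?Y \<subseteq> piece U W 0" using disjoint by (auto intro!: piece_single)
  fix Z assume Z: "unital_subring Z" "?K \<subseteq> Z" "?Y \<subseteq> Z"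
  have mono: "single m c \<in> Z" if "mdeg U m = mdeg W m" for m c
    using that
  proof (induction rule: balanced_monomial_induct)
    case zero
    then show ?case using Z by auto
  next
    case (add i j m)
    have "single (single i 1 + single j 1) 1 * single m c \<in> Z"
      using Z(3) add by (intro unital_subringD(6)[OF Z(1)]) auto
    then show ?case by (simp add: mult_single)
  qed
  show "piece U W 0 \<subseteq> Z"
  proof
    fix f :: "('v \<Rightarrow>\<^sub>0 nat) \<Rightarrow>\<^sub>0 'k" assume "f \<in> piece U W 0"
    then have "(\<Sum>m\<in>keys f. single m (lookup f m)) \<in> Z"
      using piece_degree[of f U W 0] by (intro unital_subring_sum[OF Z(1)] mono) simp
    then show "f \<in> Z" by (simp add: sum_monomials)
  qed
qed

lemma finite_bounded_monomials: "finite {m :: 'v \<Rightarrow>\<^sub>0 nat. \<forall>i. lookup m i \<le> n}"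
proof (rule finite_imageD)
  have "lookup ` {m :: 'v \<Rightarrow>\<^sub>0 nat. \<forall>i. lookup m i \<le> n} \<subseteq> PiE UNIV (\<lambda>_. {..n})" by auto
  then show "finite (lookup ` {m :: 'v \<Rightarrow>\<^sub>0 nat. \<forall>i. lookup m i \<le> n})"
    by (rule finite_subset) (simp add: finite_PiE)
  show "inj_on lookup {m :: 'v \<Rightarrow>\<^sub>0 nat. \<forall>i. lookup m i \<le> n}"
    by (rule inj_onI) simp
qed

lemma finite_chain_gauge_le:
  fixes \<W> :: "(('v \<Rightarrow>\<^sub>0 nat) \<Rightarrow>\<^sub>0 'k::field) set set"
  assumes \<W>: "\<And>A. A \<in> \<W> \<Longrightarrow> \<exists>J. ideal_of (piece U W 0) J \<and> A = J \<inter> gauge_le U W n"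
    and chain: "\<And>A A'. A \<in> \<W> \<Longrightarrow> A' \<in> \<W> \<Longrightarrow> A \<subseteq> A' \<or> A' \<subseteq> A"
  shows "finite \<W>"
proof -
  interpret V: vector_space "\<lambda>c (f :: ('v \<Rightarrow>\<^sub>0 nat) \<Rightarrow>\<^sub>0 'k). single 0 c * f"
    by unfold_locales (simp_all add: algebra_simps single_add mult_single flip: mult.assoc)
  let ?E = "(\<lambda>m. single m (1::'k)) ` {m :: 'v \<Rightarrow>\<^sub>0 nat. \<forall>i. lookup m i \<le> n}"
  have const: "single 0 c \<in> piece U W 0" for c :: 'k by (rule piece_single) simp
  show ?thesis
  proof (rule V.finite_chain_of_subspaces[of ?E])
    show "finite ?E" using finite_bounded_monomials by simp
    fix A assume "A \<in> \<W>"
    then obtain J where J: "ideal_of (piece U W 0) J" and A: "A = J \<inter> gauge_le U W n" using \<W> by blast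
    have "V.subspace A" unfolding V.subspace_def
    proof (intro conjI allI ballI)
      show "0 \<in> A" using ideal_ofD(2)[OF J] by (simp add: A gauge_le_def)
      show "f + g \<in> A" if "f \<in> A" "g \<in> A" for f g
        using that ideal_ofD(3)[OF J] keys_add[of f g] by (auto simp: A gauge_le_def intro: piece_add)
      show "single 0 c * f \<in> A" if "f \<in> A" for c f
        using that ideal_ofD(4)[OF J const] piece_mult_0[OF const]
        by (auto simp: A gauge_le_def dest: keys_single_times)
    qed
    moreover have "A \<subseteq> V.span ?E"
    proof
      fix f assume f: "f \<in> A"
      have "single m (lookup f m) \<in> V.span ?E" if m: "m \<in> keys f" for m
      proof -
        have "mdeg U m \<le> n" "mdeg U m = mdeg W m"
          using m f by (auto simp: A gauge_le_def piece_def)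
        then have "lookup m i \<le> n" for i
          using cover lookup_le_mdeg[of i U m] lookup_le_mdeg[of i W m] by (metis UNIV_I UnE le_trans)
        then have "single m 1 \<in> V.span ?E" by (intro V.span_base) auto
        then have "single 0 (lookup f m) * single m 1 \<in> V.span ?E" by (rule V.span_scale)
        then show ?thesis by (simp add: mult_single)
      qed
      then have "(\<Sum>m\<in>keys f. single m (lookup f m)) \<in> V.span ?E" by (rule V.span_sum)
      then show "f \<in> V.span ?E" by (simp add: sum_monomials)
    qed
    ultimately show "V.subspace A \<and> A \<subseteq> V.span ?E" ..
  qed (use chain in auto)
qed

text \<open>Ideals, maps and gauges are carried from the Segre ring to an isomorphic ring \<open>S\<close>.\<close>

theorem gauge_bounded_ring_if_iso:
  fixes \<theta> :: "'a \<Rightarrow> ('v \<Rightarrow>\<^sub>0 nat) \<Rightarrow>\<^sub>0 'k::field" and S :: "'a ring" (structure)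
  assumes p: "Factorial_Ring.prime CHAR('k)" and "cring S"
    and bij: "bij_betw \<theta> (carrier S) (piece U W 0)"
    and \<theta>_mult: "\<And>x y. x \<in> carrier S \<Longrightarrow> y \<in> carrier S \<Longrightarrow> \<theta> (x \<otimes> y) = \<theta> x * \<theta> y"
    and \<theta>_add: "\<And>x y. x \<in> carrier S \<Longrightarrow> y \<in> carrier S \<Longrightarrow> \<theta> (x \<oplus> y) = \<theta> x + \<theta> y"
    and \<theta>_one: "\<theta> \<one> = 1"
  shows "gauge_bounded_ring S CHAR('k) (\<lambda>n. {x \<in> carrier S. \<theta> x \<in> gauge_le U W n})"
proof -
  interpret cring S by fact
  let ?A = "piece U W 0 :: (('v \<Rightarrow>\<^sub>0 nat) \<Rightarrow>\<^sub>0 'k) set"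
  let ?p = "CHAR('k)"
  let ?Hom = "\<lambda>e. module_Hom S (Frobenius_pushforward S ?p e) (regular_module S)"
  define V where "V n = {x \<in> carrier S. \<theta> x \<in> gauge_le U W n}" for n
  define \<iota> where "\<iota> = inv_into (carrier S) \<theta>"
  have \<theta>_in: "\<theta> x \<in> ?A" if "x \<in> carrier S" for x using bij that bij_betwE by blast
  have inj: "x = y" if "x \<in> carrier S" "y \<in> carrier S" "\<theta> x = \<theta> y" for x y
    using that bij by (auto simp: bij_betw_def inj_on_def)
  have \<iota>_in: "\<iota> f \<in> carrier S" and \<theta>_\<iota>: "\<theta> (\<iota> f) = f" if "f \<in> ?A" for f
    using that bij unfolding \<iota>_def by (auto simp: bij_betw_def inv_into_into f_inv_into_f)
  have \<iota>_\<theta>: "\<iota> (\<theta> x) = x" if "x \<in> carrier S" for x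
    using that bij unfolding \<iota>_def by (simp add: bij_betw_def inv_into_f_f)
  have \<theta>_zero: "\<theta> \<zero> = 0" using \<theta>_add[of \<zero> \<zero>] by (metis add_cancel_right_left l_zero zero_closed)
  have \<theta>_pow: "\<theta> (x [^] (n::nat)) = \<theta> x ^ n" if "x \<in> carrier S" for x n
    by (induction n) (use that in \<open>auto simp: \<theta>_one \<theta>_mult mult.commute\<close>)
  have V_iff: "x \<in> V n \<longleftrightarrow> x \<in> carrier S \<and> \<theta> x \<in> gauge_le U W n" for x n by (simp add: V_def)
  have image_ideal: "ideal_of ?A (\<theta> ` I)" if I: "ideal I S" for I
    unfolding ideal_of_def
  proof (intro conjI ballI)
    interpret I: ideal I S by (rule I)
    show "\<theta> ` I \<subseteq> ?A" using \<theta>_in by auto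
    show "0 \<in> \<theta> ` I" using \<theta>_zero I.zero_closed by (metis imageI)
    show "a + b \<in> \<theta> ` I" if ab: "a \<in> \<theta> ` I" "b \<in> \<theta> ` I" for a b
    proof -
      obtain x y where xy: "x \<in> I" "y \<in> I" "a = \<theta> x" "b = \<theta> y" using ab by blast
      then have "\<theta> (x \<oplus> y) = a + b" by (simp add: \<theta>_add)
      then show ?thesis using xy I.a_closed by (metis imageI)
    qed
    show "a * b \<in> \<theta> ` I" if ab: "a \<in> ?A" "b \<in> \<theta> ` I" for a b
    proof -
      obtain y where y: "y \<in> I" "b = \<theta> y" using ab by blast
      then have "\<theta> (\<iota> a \<otimes> y) = a * b" using ab by (simp add: \<theta>_mult \<iota>_in \<theta>_\<iota>)
      then show ?thesis using y I.I_l_closed \<iota>_in[OF ab(1)] by (metis imageI)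
    qed
  qed
  have image_mem: "x \<in> I" if "ideal I S" "x \<in> carrier S" "\<theta> x \<in> \<theta> ` I" for I x
    using that inj ideal.Icarr by (metis (no_types, lifting) imageE)
  have Hom_to_cartier: "cartier_map U W (?p ^ e) (\<lambda>f. \<theta> (\<phi> (\<iota> f)))" if \<phi>: "\<phi> \<in> ?Hom e" for \<phi> e
  proof -
    have \<phi>_in: "\<phi> x \<in> carrier S" if "x \<in> carrier S" for x
      using \<phi> that by (auto simp: module_Hom_Frobenius_iff)
    have add: "\<iota> (f + g) = \<iota> f \<oplus> \<iota> g" if "f \<in> ?A" "g \<in> ?A" for f g
      using that by (intro inj) (simp_all add: \<iota>_in \<theta>_\<iota> \<theta>_add piece_add)
    have mult: "\<iota> (s ^ ?p ^ e * f) = \<iota> s [^] (?p ^ e) \<otimes> \<iota> f" if "s \<in> ?A" "f \<in> ?A" for s f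
    proof (rule inj)
      have "s ^ ?p ^ e \<in> ?A" using piece_power[OF that(1), of "?p ^ e"] by simp
      then have "s ^ ?p ^ e * f \<in> ?A" using that piece_mult_0 by blast
      then show "\<iota> (s ^ ?p ^ e * f) \<in> carrier S"
        "\<theta> (\<iota> (s ^ ?p ^ e * f)) = \<theta> (\<iota> s [^] (?p ^ e) \<otimes> \<iota> f)"
        using that by (simp_all add: \<iota>_in \<theta>_\<iota> \<theta>_mult \<theta>_pow)
    qed (use that \<iota>_in in auto)
    show ?thesis
      unfolding cartier_map_def
      using \<phi> \<phi>_in by (auto simp: \<theta>_in \<iota>_in add mult module_Hom_Frobenius_iff \<theta>_add \<theta>_mult \<theta>_\<iota>)
  qed
  have cartier_to_Hom: "(\<lambda>x. \<iota> (\<psi> (\<theta> x))) \<in> ?Hom e" if \<psi>: "cartier_map U W (?p ^ e) \<psi>" for \<psi> e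
    unfolding module_Hom_Frobenius_iff
  proof (intro conjI ballI)
    have \<psi>_in: "\<psi> (\<theta> x) \<in> ?A" if "x \<in> carrier S" for x
      using \<psi> \<theta>_in[OF that] by (auto simp: cartier_map_def)
    show "(\<lambda>x. \<iota> (\<psi> (\<theta> x))) \<in> carrier S \<rightarrow> carrier S" using \<psi>_in \<iota>_in by auto
    show "\<iota> (\<psi> (\<theta> (x \<oplus> y))) = \<iota> (\<psi> (\<theta> x)) \<oplus> \<iota> (\<psi> (\<theta> y))" if "x \<in> carrier S" "y \<in> carrier S" for x y
    proof (rule inj)
      have "\<psi> (\<theta> (x \<oplus> y)) = \<psi> (\<theta> x) + \<psi> (\<theta> y)"
        using \<psi> that \<theta>_in by (auto simp: \<theta>_add cartier_map_def)
      then show "\<theta> (\<iota> (\<psi> (\<theta> (x \<oplus> y)))) = \<theta> (\<iota> (\<psi> (\<theta> x)) \<oplus> \<iota> (\<psi> (\<theta> y)))"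
        using that \<psi>_in by (simp add: \<theta>_\<iota> \<theta>_add \<iota>_in piece_add)
    qed (use that \<psi>_in \<iota>_in in auto)
    show "\<iota> (\<psi> (\<theta> (s [^] ?p ^ e \<otimes> x))) = s \<otimes> \<iota> (\<psi> (\<theta> x))" if "s \<in> carrier S" "x \<in> carrier S" for s x
    proof (rule inj)
      have "\<psi> (\<theta> (s [^] ?p ^ e \<otimes> x)) = \<theta> s * \<psi> (\<theta> x)"
        using \<psi> that \<theta>_in by (auto simp: \<theta>_mult \<theta>_pow cartier_map_def)
      then show "\<theta> (\<iota> (\<psi> (\<theta> (s [^] ?p ^ e \<otimes> x)))) = \<theta> (s \<otimes> \<iota> (\<psi> (\<theta> x)))"
        using that \<psi>_in \<theta>_in by (simp add: \<theta>_\<iota> \<theta>_mult \<iota>_in piece_mult_0)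
    qed (use that \<psi>_in \<iota>_in in auto)
  qed
  have "gauge_bounded_ring S ?p V"
  proof (unfold_locales)
    show "\<one> \<noteq> \<zero>" using \<theta>_one \<theta>_zero by (metis zero_neq_one)
    show "x = \<zero> \<or> y = \<zero>" if "x \<otimes> y = \<zero>" "x \<in> carrier S" "y \<in> carrier S" for x y
    proof -
      have "\<theta> x * \<theta> y = 0" using that \<theta>_mult[of x y] \<theta>_zero by simp
      then show ?thesis using that inj[of x \<zero>] inj[of y \<zero>] \<theta>_zero by auto
    qed
    show "2 \<le> ?p" using p by (rule prime_ge_2_nat)
    show "V n \<subseteq> carrier S" for n by (auto simp: V_iff)
    show "V m \<subseteq> V n" if "m \<le> n" for m n using that by (fastforce simp: V_iff gauge_le_def)
    show "\<one> \<in> V 0" by (simp add: V_iff \<theta>_one gauge_le_def)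
    show "x \<otimes> y \<in> V (m + n)" if "x \<in> V m" "y \<in> V n" for x y m n
    proof -
      have "\<theta> x * \<theta> y \<in> gauge_le U W (m + n)"
        using that piece_mult_0[of "\<theta> x" U W "\<theta> y" 0]
        by (auto simp: V_iff gauge_le_def elim!: keys_timesE intro!: add_mono)
      then show ?thesis using that by (simp add: V_iff \<theta>_mult)
    qed
    show "\<exists>n. x \<in> V n" if "x \<in> carrier S" for x
    proof -
      have "mdeg U m \<le> (\<Sum>m\<in>keys (\<theta> x). mdeg U m)" if "m \<in> keys (\<theta> x)" for m
        by (rule member_le_sum) (use that in auto)
      then show ?thesis using that \<theta>_in by (auto simp: V_iff gauge_le_def)
    qed
    show "\<exists>F. finite F \<and> F \<subseteq> I \<and> I \<subseteq> Idl F" if I: "ideal I S" for I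
    proof -
      obtain F where F: "finite F" "F \<subseteq> \<theta> ` I"
        and gen: "\<And>J. ideal_of ?A J \<Longrightarrow> F \<subseteq> J \<Longrightarrow> \<theta> ` I \<subseteq> J"
        using noetherian_piece_0 image_ideal[OF I] unfolding noetherian_subring_def by meson
      obtain G where G: "finite G" "G \<subseteq> I" "F = \<theta> ` G"
        using F finite_subset_image by metis
      have Gc: "G \<subseteq> carrier S" using G ideal.Icarr[OF I] by blast
      have "\<theta> ` I \<subseteq> \<theta> ` (Idl G)"
        using gen[OF image_ideal[OF genideal_ideal[OF Gc]]] genideal_self[OF Gc] G by blast
      then have "I \<subseteq> Idl G"
        using image_mem[OF genideal_ideal[OF Gc]] ideal.Icarr[OF I] by blast
      then show ?thesis using G by blast
    qed
    show "finite \<W>" if \<W>: "\<And>A. A \<in> \<W> \<Longrightarrow> \<exists>I. ideal I S \<and> A = I \<inter> V n"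
      and chain: "\<And>A A'. A \<in> \<W> \<Longrightarrow> A' \<in> \<W> \<Longrightarrow> A \<subseteq> A' \<or> A' \<subseteq> A" for \<W> n
    proof (rule finite_imageD)
      show "finite ((`) \<theta> ` \<W>)"
      proof (rule finite_chain_gauge_le)
        fix B assume "B \<in> (`) \<theta> ` \<W>"
        then obtain I where I: "ideal I S" "B = \<theta> ` (I \<inter> V n)" using \<W> by blast
        then have "B = \<theta> ` I \<inter> gauge_le U W n" using ideal.Icarr by (fastforce simp: V_iff)
        then show "\<exists>J. ideal_of ?A J \<and> B = J \<inter> gauge_le U W n" using image_ideal I by blast
      qed (use chain in blast)
      show "inj_on ((`) \<theta>) \<W>"
      proof (rule inj_onI)
        fix A A' assume A: "A \<in> \<W>" "A' \<in> \<W>" "\<theta> ` A = \<theta> ` A'"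
        then have "A \<subseteq> carrier S" "A' \<subseteq> carrier S" using \<W>[OF A(1)] \<W>[OF A(2)] by (auto simp: V_iff)
        then show "A = A'" using A(3) bij inj_on_image_eq_iff bij_betw_imp_inj_on by metis
      qed
    qed
    show "\<phi> x \<in> Idl {\<psi> x |\<psi>. \<psi> \<in> ?Hom e \<and> \<psi> x \<in> V (G div ?p ^ e)}"
      if \<phi>: "\<phi> \<in> ?Hom e" and x: "x \<in> V G" for \<phi> e x G
    proof -
      let ?Z = "{\<psi> x |\<psi>. \<psi> \<in> ?Hom e \<and> \<psi> x \<in> V (G div ?p ^ e)}"
      have xc: "x \<in> carrier S" using x by (simp add: V_iff)
      have Z: "?Z \<subseteq> carrier S" by (auto simp: V_iff)
      have "\<theta> (\<phi> (\<iota> (\<theta> x))) \<in> \<theta> ` (Idl ?Z)"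
      proof (rule cartier_map_gauge_bound[OF p refl Hom_to_cartier[OF \<phi>]])
        show "\<theta> x \<in> gauge_le U W G" using x by (simp add: V_iff)
        show "ideal_of ?A (\<theta> ` (Idl ?Z))" by (rule image_ideal[OF genideal_ideal[OF Z]])
        fix \<psi> :: "(('v \<Rightarrow>\<^sub>0 nat) \<Rightarrow>\<^sub>0 'k) \<Rightarrow> ('v \<Rightarrow>\<^sub>0 nat) \<Rightarrow>\<^sub>0 'k"
        assume \<psi>: "cartier_map U W (?p ^ e) \<psi>" "\<psi> (\<theta> x) \<in> gauge_le U W (G div ?p ^ e)"
        then have in_A: "\<psi> (\<theta> x) \<in> ?A" by (simp add: gauge_le_def)
        have "\<iota> (\<psi> (\<theta> x)) \<in> ?Z"
          using cartier_to_Hom[OF \<psi>(1)] \<psi>(2) in_A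
          by (intro CollectI exI[of _ "\<lambda>x. \<iota> (\<psi> (\<theta> x))"]) (simp add: V_iff \<iota>_in \<theta>_\<iota>)
        then have "\<iota> (\<psi> (\<theta> x)) \<in> Idl ?Z" using genideal_self[OF Z] by blast
        then have "\<theta> (\<iota> (\<psi> (\<theta> x))) \<in> \<theta> ` (Idl ?Z)" by (rule imageI)
        then show "\<psi> (\<theta> x) \<in> \<theta> ` (Idl ?Z)" unfolding \<theta>_\<iota>[OF in_A] .
      qed
      then have "\<theta> (\<phi> x) \<in> \<theta> ` (Idl ?Z)" unfolding \<iota>_\<theta>[OF xc] .
      moreover have "\<phi> x \<in> carrier S" using \<phi> xc by (auto simp: module_Hom_Frobenius_iff)
      ultimately show ?thesis by (intro image_mem[OF genideal_ideal[OF Z]])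
    qed
    show "\<exists>\<psi>\<in>?Hom e. \<psi> x \<in> V (G div ?p ^ e) \<and> \<psi> x \<noteq> \<zero>"
      if x: "x \<in> V G" "x \<noteq> \<zero>" for x G e
    proof -
      have "\<theta> x \<noteq> 0" using x inj[of x \<zero>] \<theta>_zero by (auto simp: V_iff)
      then obtain \<psi> where \<psi>: "cartier_map U W (?p ^ e) \<psi>" "\<psi> (\<theta> x) \<in> gauge_le U W (G div ?p ^ e)"
        "\<psi> (\<theta> x) \<noteq> 0"
        using cartier_map_gauge_nonzero[OF p refl, of "\<theta> x" G e] x by (auto simp: V_iff)
      then have in_A: "\<psi> (\<theta> x) \<in> ?A" by (simp add: gauge_le_def)
      have "\<iota> (\<psi> (\<theta> x)) \<noteq> \<zero>" using \<theta>_\<iota>[OF in_A] \<psi>(3) \<theta>_zero by auto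
      then show ?thesis
        using cartier_to_Hom[OF \<psi>(1)] \<psi>(2) in_A
        by (intro bexI[of _ "\<lambda>x. \<iota> (\<psi> (\<theta> x))"]) (simp_all add: V_iff \<iota>_in \<theta>_\<iota>)
    qed
  qed
  then show ?thesis by (simp add: V_def[abs_def])
qed

end

section \<open>The determinantal ring is a Segre ring\<close>

definition map_monomials :: "('m \<Rightarrow> 'n) \<Rightarrow> ('m \<Rightarrow>\<^sub>0 'k::comm_ring_1) \<Rightarrow> ('n \<Rightarrow>\<^sub>0 'k)" where
  "map_monomials \<mu> f = (\<Sum>m\<in>keys f. single (\<mu> m) (lookup f m))"

lemma map_monomials_superset:
  assumes "finite A" "keys f \<subseteq> A"
  shows "map_monomials \<mu> f = (\<Sum>m\<in>A. single (\<mu> m) (lookup f m))"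
  unfolding map_monomials_def using assms by (intro sum.mono_neutral_left) (auto simp: in_keys_iff)

lemma map_monomials_add:
  fixes f g :: "'m \<Rightarrow>\<^sub>0 'k::comm_ring_1"
  shows "map_monomials \<mu> (f + g) = map_monomials \<mu> f + map_monomials \<mu> g"
proof -
  let ?A = "keys f \<union> keys g"
  have "map_monomials \<mu> h = (\<Sum>m\<in>?A. single (\<mu> m) (lookup h m))" if "keys h \<subseteq> ?A" for h :: "'m \<Rightarrow>\<^sub>0 'k"
    using that by (intro map_monomials_superset) auto
  then show ?thesis using keys_add[of f g] by (simp add: lookup_add single_add sum.distrib)
qed

lemma map_monomials_single [simp]: "map_monomials \<mu> (single m c) = single (\<mu> m) c"
  by (cases "c = 0") (simp_all add: map_monomials_def)

lemma map_monomials_comp: "map_monomials \<nu> (map_monomials \<mu> f) = map_monomials (\<lambda>m. \<nu> (\<mu> m)) f"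
  by (induction f rule: poly_mapping_monomial_induct) (simp_all add: map_monomials_add)

lemma map_monomials_mult:
  assumes "\<And>m n. \<mu> (m + n) = \<mu> m + \<mu> n"
  shows "map_monomials \<mu> (f * g) = map_monomials \<mu> f * map_monomials \<mu> (g :: ('m::comm_monoid_add) \<Rightarrow>\<^sub>0 'k::comm_ring_1)"
proof (induction f rule: poly_mapping_monomial_induct)
  case (single m c)
  show ?case
    by (induction g rule: poly_mapping_monomial_induct)
      (simp_all add: mult_single assms distrib_left map_monomials_add)
next
  case (add f f')
  then show ?case by (simp add: distrib_right map_monomials_add)
qed

text \<open>An order on the variables makes the polynomial ring in them an integral domain by class inference; any
linear order will do.\<close>

instantiation sum :: (linorder, linorder) linorder
begin

definition less_eq_sum :: "'a + 'b \<Rightarrow> 'a + 'b \<Rightarrow> bool" where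
  "less_eq_sum x y = (case x of Inl a \<Rightarrow> (case y of Inl a' \<Rightarrow> a \<le> a' | Inr _ \<Rightarrow> True)
     | Inr b \<Rightarrow> (case y of Inl _ \<Rightarrow> False | Inr b' \<Rightarrow> b \<le> b'))"

definition less_sum :: "'a + 'b \<Rightarrow> 'a + 'b \<Rightarrow> bool" where
  "less_sum x y = (x \<le> y \<and> \<not> y \<le> x)"

instance
  by intro_classes (auto simp: less_eq_sum_def less_sum_def split: sum.splits)

end

text \<open>The exponents of the image of a monomial under
\<open>x\<^sub>i\<^sub>j \<mapsto> s\<^sub>i t\<^sub>j\<close>.\<close>

definition margins :: "('i::finite \<times> 'j::finite \<Rightarrow>\<^sub>0 nat) \<Rightarrow> ('i + 'j \<Rightarrow>\<^sub>0 nat)" where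
  "margins M = Abs_poly_mapping (case_sum (\<lambda>i. \<Sum>j\<in>UNIV. lookup M (i, j)) (\<lambda>j. \<Sum>i\<in>UNIV. lookup M (i, j)))"

lemma lookup_margins [simp]:
  "lookup (margins M) (Inl i) = (\<Sum>j\<in>UNIV. lookup M (i, j))"
  "lookup (margins M) (Inr j) = (\<Sum>i\<in>UNIV. lookup M (i, j))"
  by (simp_all add: margins_def)

lemma poly_mapping_sum_eqI:
  assumes "\<And>i. lookup f (Inl i) = lookup g (Inl i)" "\<And>j. lookup f (Inr j) = lookup g (Inr j)"
  shows "f = g"
proof (rule poly_mapping_eqI)
  show "lookup f k = lookup g k" for k using assms by (cases k) auto
qed

lemma margins_add: "margins (M + N) = margins M + margins N"
  by (rule poly_mapping_sum_eqI) (simp_all add: lookup_add sum.distrib)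

lemma margins_0 [simp]: "margins 0 = 0"
  by (rule poly_mapping_sum_eqI) simp_all

lemma margins_single: "margins (single (i, j) c) = single (Inl i) c + single (Inr j) c"
  by (rule poly_mapping_sum_eqI) (simp_all add: lookup_add lookup_single when_def)

lemma mdeg_margins: "mdeg (range Inl) (margins M) = mdeg (range Inr) (margins M)"
  by (simp add: mdeg_def sum.reindex) (rule sum.swap)

interpretation rows_cols: covering_bipartition "range Inl :: (2 + 3) set" "range Inr :: (2 + 3) set"
proof
  show "\<exists>x\<in>range Inl. \<exists>x'\<in>range Inl. x \<noteq> (x' :: 2 + 3)"
    by (intro bexI[of _ "Inl 0"] bexI[of _ "Inl 1"]) simp_all
  show "\<exists>x\<in>range Inr. \<exists>x'\<in>range Inr. x \<noteq> (x' :: 2 + 3)"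
    by (intro bexI[of _ "Inr 0"] bexI[of _ "Inr 1"]) simp_all
  show "range Inl \<union> range Inr = (UNIV :: (2 + 3) set)"
    by (rule UNIV_sum[symmetric])
qed auto

lemma ex_margins:
  fixes m :: "2 + 3 \<Rightarrow>\<^sub>0 nat"
  assumes "mdeg (range Inl) m = mdeg (range Inr) m"
  shows "\<exists>M. margins M = m"
  using assms
proof (induction rule: rows_cols.balanced_monomial_induct)
  case zero
  show ?case by (rule exI[of _ 0]) simp
next
  case (add x y m)
  then obtain i j M where "x = Inl i" "y = Inr j" "margins M = m" by blast
  then show ?case by (intro exI[of _ "single (i, j) 1 + M"]) (simp add: margins_add margins_single)
qed

definition minors_ideal :: "('k::field) poly23 set" where
  "minors_ideal = genideal polynomial_ring_23 maximal_minors"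

lemma cring_polynomial_ring_23: "cring (polynomial_ring_23 :: ('k::field) poly23 ring)"
  unfolding polynomial_ring_23_def by (rule cring_from_type_algebra)

lemma minors_ideal: "ideal minors_ideal (polynomial_ring_23 :: ('k::field) poly23 ring)"
proof -
  interpret cring "polynomial_ring_23 :: 'k poly23 ring" by (rule cring_polynomial_ring_23)
  show ?thesis unfolding minors_ideal_def
    by (rule genideal_ideal) (simp add: polynomial_ring_23_def ring_of_type_algebra_def)
qed

lemma minors_ideal_closed:
  "(0 :: 'k poly23) \<in> minors_ideal"
  "f \<in> minors_ideal \<Longrightarrow> g \<in> minors_ideal \<Longrightarrow> f + g \<in> minors_ideal"
  "f \<in> minors_ideal \<Longrightarrow> h * f \<in> minors_ideal"
  "f \<in> maximal_minors \<Longrightarrow> f \<in> minors_ideal"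
  for f g h :: "('k::field) poly23"
proof -
  interpret cring "polynomial_ring_23 :: 'k poly23 ring" by (rule cring_polynomial_ring_23)
  interpret I: ideal minors_ideal "polynomial_ring_23 :: 'k poly23 ring" by (rule minors_ideal)
  note defs = polynomial_ring_23_def ring_of_type_algebra_def
  show "(0 :: 'k poly23) \<in> minors_ideal" using I.zero_closed by (simp add: defs)
  show "f + g \<in> minors_ideal" if "f \<in> minors_ideal" "g \<in> minors_ideal"
    using I.a_closed[OF that] by (simp add: defs)
  show "h * f \<in> minors_ideal" if "f \<in> minors_ideal"
    using I.I_l_closed[OF that, of h] by (simp add: defs)
  show "f \<in> minors_ideal" if "f \<in> maximal_minors"
    using genideal_self[of maximal_minors] that unfolding minors_ideal_def by (auto simp: defs)
qed

lemma UNIV_2: "(UNIV :: 2 set) = {0, 1}"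
proof (rule UNIV_eq_I)
  fix x :: 2
  have "x = 1 \<or> x = 2" by (rule exhaust_2)
  then show "x \<in> {0, 1}" by (elim disjE) simp_all
qed

text \<open>The maximal minors are formed with increasing column indices; for \<open>k < j\<close> the element is the negative
of a minor.\<close>

lemma minors_ideal_swap:
  assumes "j \<noteq> k"
  shows "var 0 j * var 1 k - var 0 k * var 1 j \<in> (minors_ideal :: ('k::field) poly23 set)"
proof -
  have *: "var 0 j * var 1 k - var 0 k * var 1 j \<in> (minors_ideal :: 'k poly23 set)"
    if "j < k" for j k :: 3
  proof -
    define c where "c s = (if s = 0 then j else k)" for s :: 2
    have "strict_mono c"
    proof (rule strict_monoI)
      fix x y :: 2 assume "x < y"
      moreover have "x \<in> {0, 1}" "y \<in> {0, 1}" using UNIV_2 by auto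
      moreover have "\<not> (1::2) < 0" by (simp add: less_bit0_def bit0.Rep_0 bit0.Rep_1)
      ultimately show "c x < c y" using that by (auto simp: c_def)
    qed
    then have "det (\<chi> (r::2) (s::2). var r (c s)) \<in> (maximal_minors :: 'k poly23 set)"
      unfolding maximal_minors_def by blast
    moreover have "det (\<chi> (r::2) (s::2). var r (c s)) = (var 0 j * var 1 k - var 0 k * var 1 j :: 'k poly23)"
    proof -
      \<comment> \<open>\<open>det_2\<close> names the two indices \<open>1\<close> and \<open>2\<close>, and \<open>2 = 0\<close> in this type.\<close>
      have two: "(2::2) = 0" by simp
      have "var 2 = (var 0 :: 3 \<Rightarrow> 'k poly23)" by (simp only: two)
      then show ?thesis by (simp add: det_2 c_def mult.commute)
    qed
    ultimately show ?thesis using minors_ideal_closed(4) by metis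
  qed
  show ?thesis
  proof (cases "j < k")
    case False
    then have "k < j" using assms by simp
    then have "(- 1) * (var 0 k * var 1 j - var 0 j * var 1 k) \<in> (minors_ideal :: 'k poly23 set)"
      by (intro minors_ideal_closed(3) *)
    then show ?thesis by simp
  qed (rule *)
qed

lemma minors_ideal_diff_trans:
  assumes "f - g \<in> minors_ideal" "g - h \<in> minors_ideal"
  shows "f - h \<in> (minors_ideal :: ('k::field) poly23 set)"
  using minors_ideal_closed(2)[OF assms] by simp

text \<open>Two exponent matrices with the same row and column sums are joined by swaps, each of which replaces
\<open>x\<^sub>0\<^sub>j x\<^sub>1\<^sub>k\<close> by \<open>x\<^sub>0\<^sub>k x\<^sub>1\<^sub>j\<close>. If the first rows differ, there are columns \<open>j\<close> and \<open>k\<close> in which the first row of \<open>M\<close> is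
respectively too large and too small, and the swap there brings \<open>M\<close> closer to \<open>N\<close>.\<close>

lemma minors_ideal_monomials:
  fixes M N :: "2 \<times> 3 \<Rightarrow>\<^sub>0 nat" and c :: "'k::field"
  assumes "margins M = margins N"
  shows "single M c - single N c \<in> minors_ideal"
  using assms
proof (induction "\<Sum>j\<in>UNIV. lookup M (0, j) - lookup N (0, j)" arbitrary: M rule: less_induct)
  case less
  have row: "(\<Sum>j\<in>UNIV. lookup M (0, j)) = (\<Sum>j\<in>UNIV. lookup N (0, j))"
    using arg_cong[OF less.prems, of "\<lambda>m. lookup m (Inl 0)"] by simp
  have col: "lookup M (0, j) + lookup M (1, j) = lookup N (0, j) + lookup N (1, j)" for j
    using arg_cong[OF less.prems, of "\<lambda>m. lookup m (Inr j)"] by (simp add: UNIV_2)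
  show ?case
  proof (cases "\<exists>j. lookup N (0, j) < lookup M (0, j)")
    case False
    then have le: "lookup M (0, j) \<le> lookup N (0, j)" for j by (simp add: not_less)
    have "lookup M (0, j) = lookup N (0, j)" for j
    proof (rule ccontr)
      assume "lookup M (0, j) \<noteq> lookup N (0, j)"
      then have "(\<Sum>j\<in>UNIV. lookup M (0, j)) < (\<Sum>j\<in>UNIV. lookup N (0, j))"
        using le by (intro sum_strict_mono_ex1) (auto simp: order.strict_iff_order intro!: exI[of _ j])
      then show False using row by simp
    qed
    then have "lookup M (i, j) = lookup N (i, j)" for i j
    proof -
      have "i \<in> {0, 1}" using UNIV_2 by auto
      then show ?thesis using col[of j] \<open>\<And>j. lookup M (0, j) = lookup N (0, j)\<close> by auto
    qed
    then have "M = N" by (intro poly_mapping_eqI) (metis surj_pair)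
    then show ?thesis by (simp add: minors_ideal_closed)
  next
    case True
    then obtain j where j: "lookup N (0, j) < lookup M (0, j)" by blast
    have "\<exists>k. lookup M (0, k) < lookup N (0, k)"
    proof (rule ccontr)
      assume "\<nexists>k. lookup M (0, k) < lookup N (0, k)"
      then have "(\<Sum>j\<in>UNIV. lookup N (0, j)) < (\<Sum>j\<in>UNIV. lookup M (0, j))"
        using j by (intro sum_strict_mono_ex1) (auto simp: not_less)
      then show False using row by simp
    qed
    then obtain k where k: "lookup M (0, k) < lookup N (0, k)" by blast
    have jk: "j \<noteq> k" using j k by auto
    define L where "L = M - single (0, j) 1 - single (1, k) 1"
    define M' where "M' = single (0, k) 1 + single (1, j) 1 + L"
    have pos: "1 \<le> lookup M (0, j)" "1 \<le> lookup M (1, k)" using j k col[of k] by auto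
    have M: "M = single (0, j) 1 + single (1, k) 1 + L"
      using pos by (intro poly_mapping_eqI) (auto simp: L_def lookup_add lookup_minus lookup_single when_def)
    have "margins M' = margins M"
      by (subst M) (simp add: M'_def margins_add margins_single algebra_simps)
    moreover have "(\<Sum>i\<in>UNIV. lookup M' (0, i) - lookup N (0, i)) < (\<Sum>i\<in>UNIV. lookup M (0, i) - lookup N (0, i))"
    proof (rule sum_strict_mono_ex1)
      have *: "lookup M' (0, i) = (if i = j then lookup M (0, i) - 1 else if i = k then lookup M (0, i) + 1
         else lookup M (0, i))" for i
        using pos jk by (auto simp: M'_def L_def lookup_add lookup_minus lookup_single when_def)
      show "\<forall>i\<in>UNIV. lookup M' (0, i) - lookup N (0, i) \<le> lookup M (0, i) - lookup N (0, i)"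
        using k by (auto simp: *)
      show "\<exists>i\<in>UNIV. lookup M' (0, i) - lookup N (0, i) < lookup M (0, i) - lookup N (0, i)"
        using j by (intro bexI[of _ j]) (auto simp: *)
    qed simp
    ultimately have IH: "single M' c - single N c \<in> minors_ideal" using less by simp
    have "single M c - single M' c = single L c * (var 0 j * var 1 k - var 0 k * var 1 j)"
      by (subst M) (simp add: M'_def var_def mult_single right_diff_distrib add_ac)
    then have "single M c - single M' c \<in> minors_ideal"
      using minors_ideal_closed(3)[OF minors_ideal_swap[OF jk]] by simp
    then show ?thesis using IH by (rule minors_ideal_diff_trans)
  qed
qed

definition segre :: "('k::field) poly23 \<Rightarrow> ((2 + 3 \<Rightarrow>\<^sub>0 nat) \<Rightarrow>\<^sub>0 'k)" where
  "segre = map_monomials margins"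

lemma segre_hom: "segre (f + g) = segre f + segre g" "segre (f * g) = segre f * segre g" "segre (1 :: 'k poly23) = 1"
  for f g :: "('k::field) poly23"
proof -
  show "segre (f + g) = segre f + segre g" unfolding segre_def by (rule map_monomials_add)
  show "segre (f * g) = segre f * segre g" unfolding segre_def by (rule map_monomials_mult) (rule margins_add)
  have "map_monomials margins (single 0 1) = single (margins 0) (1 :: 'k)" by (rule map_monomials_single)
  then show "segre (1 :: 'k poly23) = 1" unfolding segre_def by simp
qed

lemma segre_ring_hom:
  "ring_hom_ring (polynomial_ring_23 :: ('k::field) poly23 ring) ring_of_type_algebra segre"
proof (rule ring_hom_ringI2)
  show "ring (polynomial_ring_23 :: 'k poly23 ring)"
    unfolding polynomial_ring_23_def by (rule ring_from_type_algebra)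
  show "ring (ring_of_type_algebra :: ((2 + 3 \<Rightarrow>\<^sub>0 nat) \<Rightarrow>\<^sub>0 'k) ring)" by (rule ring_from_type_algebra)
  show "segre \<in> ring_hom (polynomial_ring_23 :: 'k poly23 ring) ring_of_type_algebra"
    by (rule ring_hom_memI)
      (simp_all add: segre_hom polynomial_ring_23_def ring_of_type_algebra_def)
qed

lemma a_kernel_segre:
  "a_kernel polynomial_ring_23 (ring_of_type_algebra :: ((2 + 3 \<Rightarrow>\<^sub>0 nat) \<Rightarrow>\<^sub>0 'k::field) ring) segre = {f. segre f = 0}"
  unfolding a_kernel_def' by (simp add: polynomial_ring_23_def ring_of_type_algebra_def)

text \<open>Choose a representative \<open>\<rho>\<close> for each pair of margins. Modulo minors, \<open>f\<close> is congruent to the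
combination of representatives that is determined by the image of \<open>f\<close>, so it vanishes with that image.\<close>

lemma segre_eq_0_iff: "segre f = 0 \<longleftrightarrow> f \<in> (minors_ideal :: ('k::field) poly23 set)"
proof
  assume "segre f = 0"
  define \<rho> :: "(2 + 3 \<Rightarrow>\<^sub>0 nat) \<Rightarrow> (2 \<times> 3 \<Rightarrow>\<^sub>0 nat)" where "\<rho> m = (SOME M. margins M = m)" for m
  have \<rho>: "margins (\<rho> (margins M)) = margins M" for M
    unfolding \<rho>_def by (rule someI[where P = "\<lambda>N. margins N = margins M"]) simp
  have "f - map_monomials \<rho> (segre f) \<in> minors_ideal"
    unfolding segre_def map_monomials_comp
  proof (induction f rule: poly_mapping_monomial_induct)
    case (single M c)
    show ?case using minors_ideal_monomials[of M "\<rho> (margins M)" c] \<rho>[of M] by simp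
  next
    case (add f g)
    then show ?case using minors_ideal_closed(2)[OF add] by (simp add: map_monomials_add algebra_simps)
  qed
  then show "f \<in> minors_ideal" using \<open>segre f = 0\<close> by (simp add: map_monomials_def)
next
  assume f: "f \<in> minors_ideal"
  have segre_uminus: "segre (- g) = - segre g" for g :: "'k poly23"
    using segre_hom(1)[of g "- g"] by (simp add: segre_def map_monomials_def eq_neg_iff_add_eq_0 add.commute)
  interpret R: cring "polynomial_ring_23 :: 'k poly23 ring" by (rule cring_polynomial_ring_23)
  interpret h: ring_hom_ring "polynomial_ring_23 :: 'k poly23 ring" ring_of_type_algebra segre
    by (rule segre_ring_hom)
  have minors: "segre g = 0" if "g \<in> maximal_minors" for g :: "'k poly23"
  proof -
    obtain c :: "2 \<Rightarrow> 3" where "g = det (\<chi> (r::2) (s::2). var r (c s))"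
      using \<open>g \<in> maximal_minors\<close> unfolding maximal_minors_def by blast
    then have "g = var 1 (c 1) * var 2 (c 2) + - (var 1 (c 2) * var 2 (c 1))"
      by (simp add: det_2)
    then show ?thesis
      by (simp only: segre_hom segre_uminus) (simp add: var_def segre_def margins_single mult_single add_ac)
  qed
  have "minors_ideal \<subseteq> a_kernel polynomial_ring_23 (ring_of_type_algebra :: ((2 + 3 \<Rightarrow>\<^sub>0 nat) \<Rightarrow>\<^sub>0 'k) ring) segre"
    unfolding minors_ideal_def
  proof (rule R.genideal_minimal[OF h.kernel_is_ideal])
    show "maximal_minors \<subseteq> a_kernel polynomial_ring_23 (ring_of_type_algebra :: ((2 + 3 \<Rightarrow>\<^sub>0 nat) \<Rightarrow>\<^sub>0 'k) ring) segre"
      unfolding a_kernel_segre using minors by blast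
  qed
  then show "segre f = 0" using f unfolding a_kernel_segre by blast
qed

lemma range_segre: "range (segre :: ('k::field) poly23 \<Rightarrow> _) = piece (range Inl) (range Inr) 0"
proof
  have "map_monomials margins f \<in> piece (range Inl) (range Inr) 0" for f :: "'k poly23"
    unfolding map_monomials_def by (intro piece_sum piece_single) (simp add: mdeg_margins)
  then show "range (segre :: 'k poly23 \<Rightarrow> _) \<subseteq> piece (range Inl) (range Inr) 0" by (auto simp: segre_def)
  show "piece (range Inl) (range Inr) 0 \<subseteq> range (segre :: 'k poly23 \<Rightarrow> _)"
  proof
    fix f :: "(2 + 3 \<Rightarrow>\<^sub>0 nat) \<Rightarrow>\<^sub>0 'k" assume f: "f \<in> piece (range Inl) (range Inr) 0"
    have "\<forall>m\<in>keys f. \<exists>M. margins M = m"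
      using piece_degree[OF f] by (intro ballI ex_margins) simp
    then obtain \<rho> where \<rho>: "\<And>m. m \<in> keys f \<Longrightarrow> margins (\<rho> m) = m" by metis
    have "segre (map_monomials \<rho> f) = map_monomials (\<lambda>m. margins (\<rho> m)) f" by (simp add: segre_def map_monomials_comp)
    also have "\<dots> = (\<Sum>m\<in>keys f. single m (lookup f m))" by (simp add: map_monomials_def \<rho>)
    also have "\<dots> = f" by (rule sum_monomials)
    finally show "f \<in> range segre" by (metis rangeI)
  qed
qed

lemma determinantal_ring_eq: "determinantal_ring = polynomial_ring_23 Quot minors_ideal"
  by (simp only: determinantal_ring_def minors_ideal_def)

lemma determinantal_ring_iso:
  "(\<lambda>Z. the_elem (segre ` Z)) \<in> ring_iso (determinantal_ring :: ('k::field) poly23 set ring)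
     (ring_of_type_algebra\<lparr>carrier := piece (range Inl) (range Inr) 0\<rparr>)"
proof -
  interpret h: ring_hom_ring "polynomial_ring_23 :: 'k poly23 ring" ring_of_type_algebra segre
    by (rule segre_ring_hom)
  have "a_kernel polynomial_ring_23 (ring_of_type_algebra :: ((2 + 3 \<Rightarrow>\<^sub>0 nat) \<Rightarrow>\<^sub>0 'k) ring) segre = minors_ideal"
    unfolding a_kernel_segre by (simp add: segre_eq_0_iff)
  moreover have "carrier (polynomial_ring_23 :: 'k poly23 ring) = UNIV"
    by (simp add: polynomial_ring_23_def ring_of_type_algebra_def)
  ultimately show ?thesis
    using h.FactRing_iso_set_aux by (simp add: determinantal_ring_eq range_segre)
qed

theorem gauge_bounded_determinantal_ring:
  assumes p: "Factorial_Ring.prime CHAR('k::field)"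
  shows "\<exists>V. gauge_bounded_ring (determinantal_ring :: 'k poly23 set ring) CHAR('k) V"
proof -
  let ?S = "determinantal_ring :: 'k poly23 set ring"
  let ?\<theta> = "\<lambda>Z :: 'k poly23 set. the_elem (segre ` Z)"
  have "cring ?S"
    unfolding determinantal_ring_eq by (rule ideal.quotient_is_cring[OF minors_ideal cring_polynomial_ring_23])
  then have "gauge_bounded_ring ?S CHAR('k) (\<lambda>n. {x \<in> carrier ?S. ?\<theta> x \<in> gauge_le (range Inl) (range Inr) n})"
    using ring_iso_memE[OF determinantal_ring_iso[where 'k = 'k]]
    by (intro rows_cols.gauge_bounded_ring_if_iso[OF p])
      (simp_all add: ring_of_type_algebra_def)
  then show ?thesis by blast
qed

theorem corollary4p6:
  fixes p :: nat
    and \<aa> :: "('k::field) poly23 set set"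
  assumes "Factorial_Ring.prime p"
    and "CHAR('k) = p"
    and "F_finite (ring_of_type_algebra :: 'k ring) p"
    and "ideal \<aa> (determinantal_ring :: 'k poly23 set ring)"
    and "in_no_minimal_prime (determinantal_ring :: 'k poly23 set ring) \<aa>"
  shows "\<forall>x::real. \<not> x islimpt
           {t. F_jumping_coefficient (determinantal_ring :: 'k poly23 set ring) p \<aa> t}"
proof -
  obtain V where "gauge_bounded_ring (determinantal_ring :: 'k poly23 set ring) p V"
    using gauge_bounded_determinantal_ring assms(1,2) by blast
  then show ?thesis
    using gauge_bounded_ring.discrete_F_jumping_coefficients assms(4,5) by blast
qed

end
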